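(* Suppose $(\Omega,\nu,T)$ is uniquely ergodic and let $\rho(E)$ denote the fibered rotation number of $(T,A^E)$. Then: (1) for every $E>\sup f_{22}$, $\mathrm n(E)=1-\rho(E)$; (2) for every $E<\inf f_{22}$, $\mathrm n(E)=\frac12-\rho(E)$.
   Context: $\Omega$ is a compact metric space, $T:\Omega\to\Omega$ a homeomorphism with unique invariant Borel probability measure $\nu$, and $f=(f_{ij}):\Omega\to M(2,\mathbb C)$ is continuous with $f(\omega)$ self-adjoint; it is assumed that for $\nu$-a.e. $\omega$ one has $f_{12}(T^i\omega)\neq0$ for all $i$ and $f_{22}(T^i\omega)\neq f_{22}(T^j\omega)$ for $i\ne j$. Put $V_\omega(n)=f(T^n\omega)$, $J=\begin{pmatrix}1&0\\0&0\end{pmatrix}$ and $(\mathcal S_\omega\boldsymbol u)(n)=J\boldsymbol u(n+1)+J\boldsymbol u(n-1)+V_\omega(n)\boldsymbol u(n)$ on $\ell^2(\mathbb Z,\mathbb C^2)$. The integrated density of states is $\mathrm n(E)=\lim_{N\to\infty}\frac1{2N}\#\{\text{eigenvalues}\le E\text{ of }\mathcal S_\omega|_{[1,N]}\}$ (limit for a.e. $\omega$, independent of $\omega$), where $\mathcal S_\omega|_{[1,N]}$ is the $2N\times2N$ block tridiagonal matrix with diagonal blocks $V_\omega(1),\dots,V_\omega(N)$ and off-diagonal blocks $J$. For real $E\notin[\inf f_{22},\sup f_{22}]$, $A^E(\omega)=\begin{pmatrix}E-f_{11}(\omega)-\frac{|f_{12}(\omega)|^2}{E-f_{22}(\omega)}&-1\\1&0\end{pmatrix}\in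 SL(2,\mathbb R)$ is continuous in $\omega$, and $\rho(E)$ is the fibered rotation number of the cocycle $(\omega,v)\mapsto(T\omega,A^E(\omega)v)$, normalized as for Schrödinger cocycles (so that for $\begin{pmatrix}E-v&-1\\1&0\end{pmatrix}$ the integrated density of states equals $1-2\rho$); in particular $\rho(E)\to1/2$ as $E\to-\infty$ and $\rho(E)\to0$ as $E\to+\infty$. *)

theory Defs
  imports "HOL-Probability.Probability" "Jordan_Normal_Form.Char_Poly"
    "Jordan_Normal_Form.Schur_Decomposition"
begin

definition tpow :: "('a \<Rightarrow> 'a) \<Rightarrow> int \<Rightarrow> 'a \<Rightarrow> 'a" where
  "tpow T i = (if 0 \<le> i then T ^^ (nat i) else (inv_into UNIV T) ^^ (nat (- i)))"

definition invariant_borel_prob :: "('a::topological_space \<Rightarrow> 'a) \<Rightarrow> 'a measure \<Rightarrow> bool" where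
  "invariant_borel_prob T \<mu> \<longleftrightarrow> sets \<mu> = sets borel \<and> prob_space \<mu> \<and>
     T \<in> measurable \<mu> \<mu> \<and> distr \<mu> \<mu> T = \<mu>"

definition uniquely_ergodic :: "('a::topological_space \<Rightarrow> 'a) \<Rightarrow> 'a measure \<Rightarrow> bool" where
  "uniquely_ergodic T \<nu> \<longleftrightarrow> invariant_borel_prob T \<nu> \<and>
     (\<forall>\<mu>. invariant_borel_prob T \<mu> \<longrightarrow> \<mu> = \<nu>)"

text \<open>The restriction of the block Jacobi operator to [1,N]: a 2N x 2N matrix,
  row/column index i corresponds to site (i div 2 + 1), component (i mod 2).
  Diagonal blocks V(n) = f(T^n omega), off-diagonal blocks J = diag(1,0).\<close>
definition trunc_op :: "('a \<Rightarrow> 'a) \<Rightarrow> ('a \<Rightarrow> complex mat) \<Rightarrow> 'a \<Rightarrow> nat \<Rightarrow> complex mat" where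
  "trunc_op T f \<omega> N = mat (2*N) (2*N) (\<lambda>(i,j).
     if i div 2 = j div 2 then f ((T ^^ (i div 2 + 1)) \<omega>) $$ (i mod 2, j mod 2)
     else if (i div 2 + 1 = j div 2 \<or> j div 2 + 1 = i div 2) \<and> i mod 2 = 0 \<and> j mod 2 = 0
     then 1 else 0)"

definition eig_count :: "complex mat \<Rightarrow> real \<Rightarrow> nat" where
  "eig_count A E = (\<Sum>x\<in>{x. poly (char_poly A) x = 0 \<and> Im x = 0 \<and> Re x \<le> E}.
      Polynomial.order x (char_poly A))"

definition ids_seq :: "('a \<Rightarrow> 'a) \<Rightarrow> ('a \<Rightarrow> complex mat) \<Rightarrow> real \<Rightarrow> 'a \<Rightarrow> nat \<Rightarrow> real" where
  "ids_seq T f E \<omega> N = real (eig_count (trunc_op T f \<omega> N) E) / (2 * real N)"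

text \<open>Canonical (Schroedinger) lift: Phi a t is the continuous lift of the action of
  [[a,-1],[1,0]] on the unit circle R/Z (angle 2 pi t), normalized by Phi 0 0 = 1/4
  (the matrix for a = 0 is the rotation by a quarter turn).\<close>
definition schr_lift_ok :: "(real \<Rightarrow> real \<Rightarrow> real) \<Rightarrow> bool" where
  "schr_lift_ok \<Phi> \<longleftrightarrow> continuous_on UNIV (\<lambda>(a,t). \<Phi> a t) \<and> \<Phi> 0 0 = 1/4 \<and>
     (\<forall>a t. let v1 = a * cos (2*pi*t) - sin (2*pi*t); v2 = cos (2*pi*t) in
        cos (2*pi*\<Phi> a t) * sqrt (v1\<^sup>2 + v2\<^sup>2) = v1 \<and> sin (2*pi*\<Phi> a t) * sqrt (v1\<^sup>2 + v2\<^sup>2) = v2)"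

definition schr_lift :: "real \<Rightarrow> real \<Rightarrow> real" where
  "schr_lift = (THE \<Phi>. schr_lift_ok \<Phi>)"

fun lift_iter :: "('a \<Rightarrow> 'a) \<Rightarrow> ('a \<Rightarrow> real) \<Rightarrow> nat \<Rightarrow> 'a \<Rightarrow> real \<Rightarrow> real" where
  "lift_iter T a 0 \<omega> t = t"
| "lift_iter T a (Suc n) \<omega> t = schr_lift (a ((T ^^ n) \<omega>)) (lift_iter T a n \<omega> t)"

definition rot_num :: "('a \<Rightarrow> 'a) \<Rightarrow> ('a \<Rightarrow> real) \<Rightarrow> real" where
  "rot_num T a = (THE r. \<forall>\<omega> t. (\<lambda>n. (lift_iter T a n \<omega> t - t) / real n) \<longlonglongrightarrow> r)"

definition AE_entry :: "('a \<Rightarrow> complex mat) \<Rightarrow> real \<Rightarrow> 'a \<Rightarrow> real" where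
  "AE_entry f E \<omega> = E - Re (f \<omega> $$ (0,0)) - (cmod (f \<omega> $$ (0,1)))\<^sup>2 / (E - Re (f \<omega> $$ (1,1)))"

end

theory Submission
  imports Defs
begin

text \<open>
  Let \<open>\<theta>(N,E)\<close> be the lifted angle reached after \<open>N\<close> steps of the cocycle \<open>A^E\<close> from angle \<open>0\<close>.
  Eliminating the second components from the eigenvalue equation (a Schur complement) leaves the
  three-term recursion of the cocycle, so off the range of \<open>f22\<close> the eigenvalues of the \<open>N\<close>-th truncation
  are the \<open>E\<close> with \<open>cos (2\<pi> \<theta>(N,E)) = 0\<close>. They are simple, because an eigenvector is determined by its
  first entry and the truncation is self-adjoint. On either side of the range the angle is continuous and strictly
  decreasing in \<open>E\<close>; it lies in \<open>[0,1/8]\<close> for large \<open>E\<close> and in \<open>[N/2 - 1/8, N/2]\<close> for very negative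
  \<open>E\<close>. Counting its crossings of \<open>1/4 + \<int>/2\<close> yields \<open>2\<theta>(N,E) + O(1)\<close> eigenvalues above \<open>E\<close> in the first
  case and \<open>N - 2\<theta>(N,E) + O(1)\<close> eigenvalues up to \<open>E\<close> in the second; divide by \<open>2N\<close>.

  That \<open>\<theta>(N,E)/N\<close> converges to a limit independent of the starting point follows from near additivity of
  the displacement once Birkhoff averages of continuous functions are known to converge everywhere. For the
  latter, any cluster point (Tychonoff) of the empirical averages is a finitely additive content; regularizing it
  gives an invariant Borel measure, which must be \<open>\<nu>\<close>.
\<close>

section \<open>Borel measures from finitely additive contents\<close>

text \<open>Limits of orbit averages along a filter inherit finite additivity, but on all subsets.
  Compactness of the space is what turns this into countable subadditivity after
  regularization.\<close>

locale finite_content =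
  fixes m :: "'a::metric_space set \<Rightarrow> real"
  assumes cpt: "compact (UNIV :: 'a set)"
    and nonneg: "0 \<le> m A"
    and add: "A \<inter> B = {} \<Longrightarrow> m (A \<union> B) = m A + m B"
    and total: "m UNIV = 1"
begin

text \<open>The two-stage regularization known from the Riesz representation theorem: open sets are
  measured from inside by closed, hence compact, sets, and arbitrary sets from outside by open
  ones.\<close>

definition inner_content :: "'a set \<Rightarrow> ennreal" where
  "inner_content U = (SUP K\<in>{K. closed K \<and> K \<subseteq> U}. ennreal (m K))"

definition outer_content :: "'a set \<Rightarrow> ennreal" where
  "outer_content A = (INF U\<in>{U. open U \<and> A \<subseteq> U}. inner_content U)"

definition content_measure :: "'a measure" where
  "content_measure = measure_of UNIV (sets borel) outer_content"

lemma content_empty: "m {} = 0"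
  using add[of "{}" "{}"] by simp

lemma content_mono: "A \<subseteq> B \<Longrightarrow> m A \<le> m B"
  using add[of A "B - A"] nonneg[of "B - A"] by (simp add: Un_absorb1)

lemma content_Un_le: "m (A \<union> B) \<le> m A + m B"
  using add[of A "B - A"] content_mono[of "B - A" B] by simp

lemma content_le_inner: "closed K \<Longrightarrow> K \<subseteq> U \<Longrightarrow> ennreal (m K) \<le> inner_content U"
  unfolding inner_content_def by (rule SUP_upper) simp

lemma inner_content_mono: "U \<subseteq> V \<Longrightarrow> inner_content U \<le> inner_content V"
  unfolding inner_content_def by (rule SUP_subset_mono) auto

lemma outer_content_le: "open U \<Longrightarrow> A \<subseteq> U \<Longrightarrow> outer_content A \<le> inner_content U"
  unfolding outer_content_def by (rule INF_lower) simp

lemma outer_content_open: "open U \<Longrightarrow> outer_content U = inner_content U"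
  by (rule antisym[OF outer_content_le])
     (auto simp: outer_content_def intro!: INF_greatest inner_content_mono)

lemma outer_content_mono: "A \<subseteq> B \<Longrightarrow> outer_content A \<le> outer_content B"
  unfolding outer_content_def by (rule INF_superset_mono) auto

lemma content_le_outer: "closed K \<Longrightarrow> ennreal (m K) \<le> outer_content K"
  unfolding outer_content_def by (auto intro!: INF_greatest content_le_inner)

lemma inner_content_le_1: "inner_content U \<le> 1"
  unfolding inner_content_def using content_mono[of _ UNIV] total
  by (auto intro!: SUP_least simp: ennreal_le_1)

text \<open>Normality does the work: the disjoint closed sets \<open>K - U\<close> and
  \<open>K - V\<close> get disjoint open neighbourhoods \<open>P\<close> and \<open>Q\<close>, so
  \<open>K\<close> is covered by the closed sets \<open>K - P\<close> inside \<open>U\<close> and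
  \<open>K - Q\<close> inside \<open>V\<close>.\<close>

lemma inner_content_Un_le:
  assumes "open U" "open V"
  shows "inner_content (U \<union> V) \<le> inner_content U + inner_content V"
  unfolding inner_content_def[of "U \<union> V"]
proof (rule SUP_least)
  fix K assume "K \<in> {K. closed K \<and> K \<subseteq> U \<union> V}"
  then have K: "closed K" "K \<subseteq> U \<union> V" by auto
  have "closed (K - U)" "closed (K - V)" "(K - U) \<inter> (K - V) = {}"
    using K assms by (auto intro: closed_Diff)
  then obtain P Q where PQ: "open P" "open Q" "K - U \<subseteq> P" "K - V \<subseteq> Q" "P \<inter> Q = {}"
    using t4_space[of "K - U" "K - V"] by auto
  have "m K = m ((K - P) \<union> (K - Q))" using PQ by (intro arg_cong[of _ _ m]) auto
  also have "\<dots> \<le> m (K - P) + m (K - Q)" by (rule content_Un_le)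
  finally have "ennreal (m K) \<le> ennreal (m (K - P)) + ennreal (m (K - Q))"
    by (simp add: nonneg flip: ennreal_plus)
  also have "\<dots> \<le> inner_content U + inner_content V"
    using PQ K by (intro add_mono content_le_inner closed_Diff) auto
  finally show "ennreal (m K) \<le> inner_content U + inner_content V" .
qed

lemma inner_content_UN_finite_le:
  assumes "\<And>i. open (U i)"
  shows "inner_content (\<Union>i<n::nat. U i) \<le> (\<Sum>i<n. inner_content (U i))"
proof (induction n)
  case 0
  show ?case by (auto simp: inner_content_def content_empty intro!: SUP_least)
next
  case (Suc n)
  have "inner_content (\<Union>i<Suc n. U i) \<le> inner_content (\<Union>i<n. U i) + inner_content (U n)"
    using assms inner_content_Un_le[of "\<Union>i<n. U i" "U n"] by (auto simp: lessThan_Suc Un_commute)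
  then show ?case using Suc by (auto intro: order_trans add_mono)
qed

text \<open>By compactness a closed subset of the union already lies in finitely many of the
  \<open>U i\<close>.\<close>

lemma inner_content_UN_le:
  assumes "\<And>i. open (U i)"
  shows "inner_content (\<Union>i::nat. U i) \<le> (\<Sum>i. inner_content (U i))"
  unfolding inner_content_def[of "\<Union>i. U i"]
proof (rule SUP_least)
  fix K assume "K \<in> {K. closed K \<and> K \<subseteq> (\<Union>i. U i)}"
  then have K: "closed K" "K \<subseteq> (\<Union>i. U i)" by auto
  then have "compact K" using cpt compact_Int_closed[of UNIV K] by simp
  then obtain I where I: "finite I" "K \<subseteq> (\<Union>i\<in>I. U i)"
    using K assms compactE_image[of K UNIV U] by auto
  then obtain n where "I \<subseteq> {..<n}" using finite_nat_bounded by blast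
  then have "K \<subseteq> (\<Union>i<n. U i)" using I by blast
  then have "ennreal (m K) \<le> inner_content (\<Union>i<n. U i)" by (intro content_le_inner K)
  also have "\<dots> \<le> (\<Sum>i<n. inner_content (U i))" by (rule inner_content_UN_finite_le[OF assms])
  also have "\<dots> \<le> (\<Sum>i. inner_content (U i))" by (intro sum_le_suminf) auto
  finally show "ennreal (m K) \<le> (\<Sum>i. inner_content (U i))" .
qed

lemma outer_content_UN_le: "outer_content (\<Union>i::nat. A i) \<le> (\<Sum>i. outer_content (A i))"
proof (rule ennreal_le_epsilon)
  fix e :: real assume e: "0 < e" and fin: "(\<Sum>i. outer_content (A i)) < Orderings.top"
  \<comment> \<open>Covers with errors \<open>e/2^(i+1)\<close>, which sum to \<open>e\<close>;
    finiteness of the sum makes the strict inequalities possible.\<close>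
  have "\<exists>U. open U \<and> A i \<subseteq> U \<and> inner_content U \<le> outer_content (A i) + e * (1/2)^Suc i" for i
  proof -
    have "outer_content (A i) < outer_content (A i) + ennreal (e * (1/2)^Suc i)"
      using e fin by (auto simp add: less_top dest!: ennreal_suminf_lessD)
    then show ?thesis unfolding outer_content_def[of "A i"]
      by (subst (asm) INF_less_iff) (auto intro: less_imp_le)
  qed
  then obtain U where U: "\<And>i. open (U i)" "\<And>i. A i \<subseteq> U i"
    "\<And>i. inner_content (U i) \<le> outer_content (A i) + e * (1/2)^Suc i" by metis
  have "outer_content (\<Union>i. A i) \<le> inner_content (\<Union>i. U i)"
    using U by (intro outer_content_le) blast+
  also have "\<dots> \<le> (\<Sum>i. inner_content (U i))" by (rule inner_content_UN_le[OF U(1)])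
  also have "\<dots> \<le> (\<Sum>i. outer_content (A i) + e * (1/2) ^ Suc i)"
    by (intro suminf_le allI U) auto
  also have "... = (\<Sum>n. outer_content (A n)) + (\<Sum>n. ennreal e * ennreal ((1/2) ^ Suc n))"
    using e by (subst suminf_add[symmetric])
      (auto simp del: ennreal_suminf_cmult simp add: ennreal_mult[symmetric])
  also have "\<dots> = (\<Sum>n. outer_content (A n)) + e"
    unfolding ennreal_suminf_cmult
    by (subst suminf_ennreal_eq[OF zero_le_power power_half_series]) auto
  finally show "outer_content (\<Union>i. A i) \<le> (\<Sum>n. outer_content (A n)) + e" .
qed

lemma outer_content_empty: "outer_content {} = 0"
  by (simp add: outer_content_open) (simp add: inner_content_def content_empty)

lemma outer_content_Un_le: "outer_content (A \<union> B) \<le> outer_content A + outer_content B"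
proof -
  let ?C = "\<lambda>i::nat. if i = 0 then A else if i = 1 then B else {}"
  have eq: "A \<union> B = (\<Union>i. ?C i)" by (auto split: if_splits)
  have "outer_content (\<Union>i. ?C i) \<le> (\<Sum>i. outer_content (?C i))" by (rule outer_content_UN_le)
  also have "\<dots> = (\<Sum>i\<in>{0,1}. outer_content (?C i))"
    by (rule suminf_finite) (auto simp: outer_content_empty)
  finally show ?thesis unfolding eq by simp
qed

text \<open>The Caratheodory condition. For an open \<open>V\<close> containing \<open>A\<close>,
  exhaust \<open>V \<inter> U\<close> by closed sets \<open>K\<close>, and then
  \<open>V - K\<close>, which contains \<open>A - U\<close>, by closed sets \<open>L\<close>;
  \<open>K\<close> and \<open>L\<close> are disjoint, so their contents add up inside
  \<open>V\<close>.\<close>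

lemma outer_content_split_open:
  assumes U: "open U"
  shows "outer_content A = outer_content (A \<inter> U) + outer_content (A - U)"
proof (rule antisym)
  show "outer_content A \<le> outer_content (A \<inter> U) + outer_content (A - U)"
    using outer_content_Un_le[of "A \<inter> U" "A - U"] by (simp add: Int_Diff_Un)
  show "outer_content (A \<inter> U) + outer_content (A - U) \<le> outer_content A"
    unfolding outer_content_def[of A]
  proof (rule INF_greatest)
    fix V assume "V \<in> {V. open V \<and> A \<subseteq> V}"
    then have V: "open V" "A \<subseteq> V" by auto
    have "ennreal (m K) + outer_content (A - U) \<le> inner_content V"
      if K: "closed K" "K \<subseteq> V \<inter> U" for K
    proof -
      have "outer_content (A - U) \<le> inner_content (V - K)"
        using V K by (intro outer_content_le open_Diff) auto
      moreover have "ennreal (m K) + inner_content (V - K) \<le> inner_content V"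
        unfolding inner_content_def[of "V - K"]
      proof (subst ennreal_SUP_add_right)
        show "{L. closed L \<and> L \<subseteq> V - K} \<noteq> {}" by (auto intro!: exI[of _ "{}"])
        show "(SUP L\<in>{L. closed L \<and> L \<subseteq> V - K}. ennreal (m K) + ennreal (m L)) \<le> inner_content V"
        proof (rule SUP_least)
          fix L assume L: "L \<in> {L. closed L \<and> L \<subseteq> V - K}"
          then have "m (K \<union> L) = m K + m L" by (intro add) auto
          then have "ennreal (m K) + ennreal (m L) = ennreal (m (K \<union> L))"
            by (simp add: nonneg flip: ennreal_plus)
          also have "\<dots> \<le> inner_content V" using K L by (intro content_le_inner) auto
          finally show "ennreal (m K) + ennreal (m L) \<le> inner_content V" .
        qed
      qed
      ultimately show ?thesis by (meson add_left_mono order_trans)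
    qed
    then have "inner_content (V \<inter> U) + outer_content (A - U) \<le> inner_content V"
      unfolding inner_content_def[of "V \<inter> U"]
      by (subst ennreal_SUP_add_left[symmetric]) (auto intro!: SUP_least exI[of _ "{}"])
    moreover have "outer_content (A \<inter> U) \<le> inner_content (V \<inter> U)"
      using V U by (intro outer_content_le) auto
    ultimately show "outer_content (A \<inter> U) + outer_content (A - U) \<le> inner_content V"
      by (meson add_right_mono order_trans)
  qed
qed

section \<open>The regularized measure on the Borel sets\<close>

lemma outer_content_measure_space: "measure_space UNIV (sets borel) outer_content"
proof -
  have oms: "outer_measure_space (Pow UNIV) outer_content"
    unfolding outer_measure_space_def positive_def increasing_def countably_subadditive_def
    using outer_content_empty outer_content_mono outer_content_UN_le by blast
  interpret P: sigma_algebra UNIV "Pow (UNIV :: 'a set)" by (rule sigma_algebra_Pow)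
  let ?L = "lambda_system UNIV (Pow UNIV) outer_content"
  have ms: "measure_space UNIV ?L outer_content" by (rule P.caratheodory_lemma[OF oms])
  then interpret L: sigma_algebra UNIV ?L by (simp add: measure_space_def)
  \<comment> \<open>The Caratheodory-measurable sets form a sigma-algebra, so containing the open
    sets is enough.\<close>
  have "Collect open \<subseteq> ?L"
  proof
    fix U :: "'a set" assume "U \<in> Collect open"
    then show "U \<in> ?L"
      unfolding P.lambda_system_eq using outer_content_split_open[of U, symmetric] by simp
  qed
  then have "sigma_sets UNIV (Collect open) \<subseteq> ?L" by (rule L.sigma_sets_subset)
  then have sub: "sets borel \<subseteq> ?L" by (simp add: borel_def)
  have "sigma_algebra UNIV (sets (borel :: 'a measure))"
    using sets.sigma_algebra_axioms[of "borel :: 'a measure"] by simp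
  then show ?thesis using ms sub
    by (auto simp: measure_space_def positive_def countably_additive_def subset_eq)
qed

lemma sets_content_measure: "sets content_measure = sets borel"
  unfolding content_measure_def
  by (subst sets_measure_of) (auto simp: sets.sigma_sets_eq[of borel, simplified])

lemma space_content_measure: "space content_measure = UNIV"
  unfolding content_measure_def by (subst space_measure_of) auto

lemma emeasure_content_measure:
  "A \<in> sets borel \<Longrightarrow> emeasure content_measure A = outer_content A"
  using outer_content_measure_space
  by (intro emeasure_measure_of[OF content_measure_def])
     (auto simp: measure_space_def sets_content_measure)

lemma prob_space_content_measure: "prob_space content_measure"
proof (rule prob_spaceI)
  have "outer_content UNIV = 1"
    using content_le_inner[of UNIV UNIV] total inner_content_le_1[of UNIV]
    by (auto simp: outer_content_open intro: antisym)
  then show "emeasure content_measure (space content_measure) = 1"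
    by (simp add: space_content_measure emeasure_content_measure)
qed

text \<open>Approximation from outside can enlarge the value of a closed set, hence an inequality.
  It suffices for upper bounds on limits of averages; lower bounds follow by passing to
  \<open>-h\<close>.\<close>

lemma content_le_measure: "closed K \<Longrightarrow> m K \<le> measure content_measure K"
proof -
  assume "closed K"
  interpret prob_space content_measure by (rule prob_space_content_measure)
  have "ennreal (m K) \<le> emeasure content_measure K"
    using content_le_outer[OF \<open>closed K\<close>] \<open>closed K\<close> by (simp add: emeasure_content_measure)
  then show ?thesis by (simp add: emeasure_eq_measure)
qed

text \<open>A homeomorphism permutes the closed sets and the open sets, so the supremum and the
  infimum of the regularization are both preserved.\<close>

lemma distr_content_measure:
  assumes T: "bij T" "continuous_on UNIV T" "continuous_on UNIV (inv_into UNIV T)"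
    and minv: "\<And>A. m (T -` A) = m A"
  shows "distr content_measure content_measure T = content_measure"
proof (rule measure_eqI)
  have open_vimage_iff: "open (T -` U) \<longleftrightarrow> open U" for U
  proof
    assume "open (T -` U)"
    then have "open (inv_into UNIV T -` (T -` U))" using T(3) by (auto intro: open_vimage)
    moreover have "inv_into UNIV T -` (T -` U) = U"
      using T(1) by (auto simp: bij_is_surj surj_f_inv_f)
    ultimately show "open U" by simp
  qed (use T(2) in \<open>auto intro: open_vimage\<close>)
  have im: "T -` (T ` A) = A" "T ` (T -` A) = A" for A
    using T(1) by (simp_all add: bij_is_inj bij_is_surj inj_vimage_image_eq surj_image_vimage_eq)
  have closed_vimage_iff: "closed (T -` K) \<longleftrightarrow> closed K" for K
    using open_vimage_iff[of "- K"] by (simp add: closed_def vimage_Compl)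
  have inner: "inner_content (T -` U) = inner_content U" for U
    unfolding inner_content_def
  proof (rule SUP_eq)
    fix K assume "K \<in> {K. closed K \<and> K \<subseteq> T -` U}"
    then show "\<exists>L\<in>{K. closed K \<and> K \<subseteq> U}. ennreal (m K) \<le> ennreal (m L)"
      using closed_vimage_iff[of "T ` K"] minv[of "T ` K"] by (intro bexI[of _ "T ` K"]) (auto simp: im)
  next
    fix K assume "K \<in> {K. closed K \<and> K \<subseteq> U}"
    then show "\<exists>L\<in>{K. closed K \<and> K \<subseteq> T -` U}. ennreal (m K) \<le> ennreal (m L)"
      using closed_vimage_iff[of K] minv[of K] by (intro bexI[of _ "T -` K"]) auto
  qed
  have outer: "outer_content (T -` A) = outer_content A" for A
    unfolding outer_content_def
  proof (rule INF_eq)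
    fix U assume "U \<in> {U. open U \<and> A \<subseteq> U}"
    then show "\<exists>V\<in>{U. open U \<and> T -` A \<subseteq> U}. inner_content V \<le> inner_content U"
      by (intro bexI[of _ "T -` U"]) (auto simp: inner open_vimage_iff)
  next
    fix U assume "U \<in> {U. open U \<and> T -` A \<subseteq> U}"
    then have U: "open U" "T -` A \<subseteq> U" by auto
    then have "open (T ` U)" "A \<subseteq> T ` U"
      using open_vimage_iff[of "T ` U"] image_mono[OF U(2), of T] unfolding im by auto
    then show "\<exists>V\<in>{U. open U \<and> A \<subseteq> U}. inner_content V \<le> inner_content U"
      using inner[of "T ` U"] by (intro bexI[of _ "T ` U"]) (auto simp: im)
  qed
  fix A assume A: "A \<in> sets (distr content_measure content_measure T)"
  then have A': "A \<in> sets borel" by (simp add: sets_content_measure)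
  have Tb: "T \<in> borel_measurable borel" using T(2) by (rule borel_measurable_continuous_onI)
  then have Tm: "T \<in> measurable content_measure content_measure"
    by (simp cong: measurable_cong_sets add: sets_content_measure)
  have "T -` A \<in> sets borel" using measurable_sets[OF Tb A'] by simp
  then show "emeasure (distr content_measure content_measure T) A = emeasure content_measure A"
    using A A' Tm by (simp add: emeasure_distr space_content_measure emeasure_content_measure outer)
qed simp

end

section \<open>Birkhoff averages under unique ergodicity\<close>

lemma compact_pointwise_bounded:
  "compact {g :: 'b \<Rightarrow> real. \<forall>x. g x \<in> {a..b}}"
proof -
  have "compactin (product_topology (\<lambda>_. euclidean) UNIV) (PiE UNIV (\<lambda>_::'b. {a..b}))"
    by (subst compactin_PiE) auto
  moreover have "PiE UNIV (\<lambda>_::'b. {a..b}) = {g. \<forall>x. g x \<in> {a..b}}" by (auto simp: PiE_iff)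
  ultimately show ?thesis by (simp add: euclidean_product_topology)
qed

text \<open>Tychonoff gives a cluster point; a finer filter turns it into a limit at all
  \<open>x\<close> simultaneously. Filters replace subsequences because the product over
  \<open>'b\<close> need not be metrizable.\<close>

lemma pointwise_convergent_subfilter:
  fixes X :: "'i \<Rightarrow> 'b \<Rightarrow> real"
  assumes F: "F \<noteq> bot" and X: "\<And>n x. X n x \<in> {a..b}"
  obtains G l where "G \<noteq> bot" "G \<le> F" "\<And>x. ((\<lambda>n. X n x) \<longlongrightarrow> l x) G"
proof -
  have "filtermap X F \<noteq> bot" using F by (simp add: filtermap_bot_iff)
  moreover have "eventually (\<lambda>g. g \<in> {g. \<forall>x. g x \<in> {a..b}}) (filtermap X F)"
    using X by (simp add: eventually_filtermap)
  ultimately obtain l where l: "inf (nhds l) (filtermap X F) \<noteq> bot"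
    using compact_pointwise_bounded[of a b, where 'b='b] unfolding compact_filter by blast
  \<comment> \<open>Adding the preimages of the neighbourhoods of \<open>l\<close> to
    \<open>F\<close> forces convergence; the result is proper because \<open>l\<close> is a cluster
    point.\<close>
  define G where "G = inf (filtercomap X (nhds l)) F"
  have "G \<noteq> bot"
  proof
    assume "G = bot"
    then have "eventually (\<lambda>_. False) G" by simp
    then obtain P Q where P: "eventually P (filtercomap X (nhds l))" and Q: "eventually Q F"
      and PQ: "\<And>n. P n \<Longrightarrow> Q n \<Longrightarrow> False"
      unfolding G_def eventually_inf by blast
    obtain P' where P': "eventually P' (nhds l)" "\<And>n. P' (X n) \<Longrightarrow> P n"
      using P unfolding eventually_filtercomap by blast
    have "eventually (\<lambda>g. \<not> P' g) (filtermap X F)"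
      unfolding eventually_filtermap using Q by eventually_elim (use P' PQ in blast)
    then have "eventually (\<lambda>_. False) (inf (nhds l) (filtermap X F))"
      unfolding eventually_inf using P' by blast
    then show False using l by (simp add: trivial_limit_def)
  qed
  moreover have "G \<le> F" unfolding G_def by simp
  moreover have "((\<lambda>n. X n x) \<longlongrightarrow> l x) G" for x
  proof -
    have "(X \<longlongrightarrow> l) G"
      unfolding G_def filterlim_iff_le_filtercomap by simp
    then have "eventually (\<lambda>n. X n \<in> (\<lambda>g. g x) -` S) G" if "open S" "l x \<in> S" for S
      using that open_vimage[OF that(1) continuous_on_product_coordinates[of x]]
      by (auto simp: tendsto_def)
    then show ?thesis by (auto intro: topological_tendstoI)
  qed
  ultimately show thesis by (rule that)
qed

text \<open>Layer-cake approximation: reduces averages of a continuous function to averages of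
  indicators of closed sets.\<close>
lemma sum_superlevel_indicators:
  fixes y :: real
  assumes "0 \<le> y" "y \<le> real n"
  shows "(\<Sum>k=1..n. indicator {real k..} y :: real) \<le> y" "y \<le> 1 + (\<Sum>k=1..n. indicator {real k..} y)"
proof -
  have fl: "nat \<lfloor>y\<rfloor> \<le> n" using assms by linarith
  have "(\<Sum>k=1..n. indicator {real k..} y :: real) = (\<Sum>k=1..n. if real k \<le> y then 1 else 0)"
    by (intro sum.cong) (auto simp: indicator_def)
  also have "\<dots> = (\<Sum>k\<in>{k\<in>{1..n}. real k \<le> y}. 1)"
    by (rule sum.inter_filter[symmetric]) simp
  also have "{k\<in>{1..n}. real k \<le> y} = {1..nat \<lfloor>y\<rfloor>}"
  proof (rule Set.set_eqI)
    fix k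
    have "real k \<le> y \<longleftrightarrow> k \<le> nat \<lfloor>y\<rfloor>" using assms by linarith
    then show "k \<in> {k\<in>{1..n}. real k \<le> y} \<longleftrightarrow> k \<in> {1..nat \<lfloor>y\<rfloor>}" using fl by auto
  qed
  finally have "(\<Sum>k=1..n. indicator {real k..} y :: real) = real (nat \<lfloor>y\<rfloor>)" by simp
  then show "(\<Sum>k=1..n. indicator {real k..} y :: real) \<le> y"
    "y \<le> 1 + (\<Sum>k=1..n. indicator {real k..} y)" using assms by linarith+
qed

section \<open>Birkhoff averages and their cluster points\<close>

definition birkhoff_avg :: "('a \<Rightarrow> 'a) \<Rightarrow> ('a \<Rightarrow> real) \<Rightarrow> 'a \<Rightarrow> nat \<Rightarrow> real" where
  "birkhoff_avg T h \<omega> n = (\<Sum>i<n. h ((T ^^ i) \<omega>)) / real n"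

lemma birkhoff_avg_mono: "(\<And>\<omega>. g \<omega> \<le> h \<omega>) \<Longrightarrow> birkhoff_avg T g \<omega> n \<le> birkhoff_avg T h \<omega> n"
  unfolding birkhoff_avg_def by (intro divide_right_mono sum_mono) auto

lemma birkhoff_avg_const: "0 < n \<Longrightarrow> birkhoff_avg T (\<lambda>_. c) \<omega> n = c"
  by (simp add: birkhoff_avg_def)

lemma birkhoff_avg_add:
  "birkhoff_avg T (\<lambda>\<omega>. g \<omega> + h \<omega>) \<omega> n = birkhoff_avg T g \<omega> n + birkhoff_avg T h \<omega> n"
  by (simp add: birkhoff_avg_def sum.distrib add_divide_distrib)

lemma birkhoff_avg_cmult: "birkhoff_avg T (\<lambda>\<omega>. c * h \<omega>) \<omega> n = c * birkhoff_avg T h \<omega> n"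
  by (simp add: birkhoff_avg_def flip: sum_distrib_left)

lemma birkhoff_avg_sum:
  "birkhoff_avg T (\<lambda>\<omega>. \<Sum>k\<in>K. h k \<omega>) \<omega> n = (\<Sum>k\<in>K. birkhoff_avg T (h k) \<omega> n)"
  unfolding birkhoff_avg_def by (subst sum.swap) (simp add: sum_divide_distrib)

text \<open>The sums telescope to one boundary difference; this makes every limit of the averages
  invariant.\<close>

lemma birkhoff_avg_shift:
  assumes "\<And>\<omega>. \<bar>h \<omega>\<bar> \<le> B"
  shows "\<bar>birkhoff_avg T (h \<circ> T) \<omega> n - birkhoff_avg T h \<omega> n\<bar> \<le> 2 * B / real n"
proof -
  have "(\<Sum>i<n. h (T ((T ^^ i) \<omega>))) - (\<Sum>i<n. h ((T ^^ i) \<omega>)) = h ((T ^^ n) \<omega>) - h \<omega>"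
    using sum_lessThan_telescope[of "\<lambda>i. h ((T ^^ i) \<omega>)" n] by (simp add: sum_subtractf)
  moreover have "\<bar>h ((T ^^ n) \<omega>) - h \<omega>\<bar> \<le> 2 * B"
    using assms[of \<omega>] assms[of "(T ^^ n) \<omega>"] by linarith
  ultimately show ?thesis
    by (simp add: birkhoff_avg_def divide_right_mono flip: diff_divide_distrib)
qed

lemma birkhoff_avg_indicator_limit:
  fixes T :: "'a::metric_space \<Rightarrow> 'a"
  assumes cpt: "compact (UNIV :: 'a set)"
    and G: "G \<noteq> bot" "G \<le> sequentially"
    and lim: "\<And>A. (birkhoff_avg T (indicator A) \<omega> \<longlongrightarrow> m A) G"
  shows "finite_content m" "m (T -` A) = m A"
proof -
  have pos: "eventually (\<lambda>n. 0 < n) G"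
    using G(2) eventually_gt_at_top by (rule filter_leD)
  show "finite_content m"
  proof
    show "compact (UNIV :: 'a set)" by fact
  next
    fix A show "0 \<le> m A"
      by (rule tendsto_lowerbound[OF lim _ G(1)])
         (auto simp: birkhoff_avg_def intro!: always_eventually divide_nonneg_nonneg sum_nonneg)
  next
    fix A B :: "'a set" assume AB: "A \<inter> B = {}"
    have "indicator (A \<union> B) = (\<lambda>x. indicator A x + indicator B x :: real)"
      using AB by (auto simp: fun_eq_iff indicator_def)
    then have "birkhoff_avg T (indicator (A \<union> B)) \<omega> =
      (\<lambda>n. birkhoff_avg T (indicator A) \<omega> n + birkhoff_avg T (indicator B) \<omega> n)"
      by (intro ext) (simp only: birkhoff_avg_add)
    then show "m (A \<union> B) = m A + m B"
      using tendsto_unique[OF G(1) lim[of "A \<union> B"]] tendsto_add[OF lim[of A] lim[of B]] by simp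
  next
    have "eventually (\<lambda>n. birkhoff_avg T (indicator UNIV) \<omega> n = 1) G"
      using pos by eventually_elim (simp add: birkhoff_avg_def)
    then show "m UNIV = 1"
      using tendsto_unique[OF G(1) lim[of UNIV] tendsto_eventually] by blast
  qed
  have "((\<lambda>n. birkhoff_avg T (indicator (T -` A)) \<omega> n - birkhoff_avg T (indicator A) \<omega> n) \<longlongrightarrow> 0) G"
  proof (rule tendsto_mono[OF G(2)], rule Lim_null_comparison)
    show "\<forall>\<^sub>F n in sequentially. norm (birkhoff_avg T (indicator (T -` A)) \<omega> n -
        birkhoff_avg T (indicator A) \<omega> n) \<le> 2 * 1 / real n"
    proof (intro always_eventually allI)
      fix n
      have eq: "indicator (T -` A) = (indicator A :: 'a \<Rightarrow> real) \<circ> T"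
        by (rule ext) (simp add: indicator_def)
      have bound: "\<bar>indicator A x :: real\<bar> \<le> 1" for x :: 'a by (simp add: indicator_def)
      show "norm (birkhoff_avg T (indicator (T -` A)) \<omega> n -
        birkhoff_avg T (indicator A) \<omega> n) \<le> 2 * 1 / real n"
        unfolding eq real_norm_def by (rule birkhoff_avg_shift[OF bound])
    qed
    show "(\<lambda>n. 2 * 1 / real n) \<longlonglongrightarrow> 0" by real_asymp
  qed
  moreover have "((\<lambda>n. birkhoff_avg T (indicator (T -` A)) \<omega> n - birkhoff_avg T (indicator A) \<omega> n)
      \<longlongrightarrow> m (T -` A) - m A) G"
    by (intro tendsto_diff lim)
  ultimately show "m (T -` A) = m A" using tendsto_unique[OF G(1)] by force
qed

text \<open>Squeeze \<open>h\<close> between step functions built on its superlevel sets. These are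
  closed, so \<open>m\<close> is bounded there by the regularized measure, and the step height
  \<open>2 * B / real M\<close> can be made small.\<close>

lemma (in finite_content) birkhoff_limit_le_integral:
  fixes T :: "'a \<Rightarrow> 'a" and h :: "'a \<Rightarrow> real"
  assumes h: "continuous_on UNIV h"
    and G: "G \<noteq> bot" "G \<le> sequentially"
    and lim: "\<And>A. (birkhoff_avg T (indicator A) \<omega> \<longlongrightarrow> m A) G"
    and l: "(birkhoff_avg T h \<omega> \<longlongrightarrow> l) G"
  shows "l \<le> integral\<^sup>L content_measure h"
proof -
  interpret P: prob_space content_measure by (rule prob_space_content_measure)
  have pos: "eventually (\<lambda>n. 0 < n) G"
    using G(2) eventually_gt_at_top by (rule filter_leD)
  obtain B where B: "0 < B" "\<And>\<omega>. \<bar>h \<omega>\<bar> \<le> B"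
    using compact_imp_bounded[OF compact_continuous_image[OF h cpt]] by (auto simp: bounded_pos)
  have hm: "h \<in> borel_measurable content_measure"
    using borel_measurable_continuous_onI[OF h] sets_content_measure measurable_cong_sets by blast
  have hi: "integrable content_measure h"
    by (rule P.integrable_const_bound[of _ B]) (use B hm in auto)
  have "l \<le> integral\<^sup>L content_measure h + 2 * B / real M" if M: "0 < M" for M :: nat
  proof -
    define d where "d = 2 * B / real M"
    have d: "0 < d" and Md: "real M * d = 2 * B" using B M by (simp_all add: d_def)
    \<comment> \<open>The levels cut \<open>[-B, B]\<close> into \<open>M\<close> steps of height
      \<open>d\<close>; the rescaled function \<open>(h x + B) / d\<close> ranges over
      \<open>[0, M]\<close>, as the layer-cake lemma requires.\<close>
    define S where "S k = {x. - B + d * real k \<le> h x}" for k :: nat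
    have cS: "closed (S k)" for k unfolding S_def
      using closed_Collect_le[OF continuous_on_const h] by simp
    have Sb: "S k \<in> sets content_measure" for k
      using cS[of k] by (simp add: sets_content_measure borel_closed)
    have y: "0 \<le> (h x + B) / d" "(h x + B) / d \<le> real M" for x
      using B(2)[of x] d Md by (auto simp: pos_divide_le_eq abs_le_iff intro!: divide_nonneg_pos)
    have ind: "indicator {real k..} ((h x + B) / d) = (indicator (S k) x :: real)" for k x
      using d by (auto simp: S_def indicator_def field_simps)
    have le: "- B + d * (\<Sum>k=1..M. indicator (S k) x) \<le> h x"
      and ge: "h x \<le> - B + d + d * (\<Sum>k=1..M. indicator (S k) x)" for x
      using sum_superlevel_indicators[OF y[of x]] d unfolding ind by (auto simp: field_simps)
    have "eventually (\<lambda>n. birkhoff_avg T h \<omega> n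
       \<le> - B + d + d * (\<Sum>k=1..M. birkhoff_avg T (indicator (S k)) \<omega> n)) G"
      using pos
    proof eventually_elim
      case (elim n)
      have "birkhoff_avg T h \<omega> n \<le> birkhoff_avg T (\<lambda>x. - B + d + d * (\<Sum>k=1..M. indicator (S k) x)) \<omega> n"
        by (rule birkhoff_avg_mono) (rule ge)
      also have "\<dots> = - B + d + d * (\<Sum>k=1..M. birkhoff_avg T (indicator (S k)) \<omega> n)"
        unfolding birkhoff_avg_add birkhoff_avg_cmult birkhoff_avg_sum birkhoff_avg_const[OF elim] ..
      finally show ?case .
    qed
    moreover have "((\<lambda>n. - B + d + d * (\<Sum>k=1..M. birkhoff_avg T (indicator (S k)) \<omega> n))
        \<longlongrightarrow> - B + d + d * (\<Sum>k=1..M. m (S k))) G"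
      by (intro tendsto_intros lim)
    ultimately have "l \<le> - B + d + d * (\<Sum>k=1..M. m (S k))"
      using l G(1) tendsto_le by blast
    also have "\<dots> \<le> - B + d + d * (\<Sum>k=1..M. measure content_measure (S k))"
      using d by (intro add_left_mono mult_left_mono sum_mono content_le_measure cS) auto
    also have "\<dots> = d + (\<integral>x. - B + d * (\<Sum>k=1..M. indicator (S k) x) \<partial>content_measure)"
      using Sb by (simp add: P.prob_space P.emeasure_eq_measure)
    also have "(\<integral>x. - B + d * (\<Sum>k=1..M. indicator (S k) x) \<partial>content_measure)
        \<le> integral\<^sup>L content_measure h"
      using Sb hi le by (intro integral_mono) (auto simp: P.emeasure_eq_measure)
    finally show ?thesis by (simp add: d_def)
  qed
  then have ev: "eventually (\<lambda>M. l \<le> integral\<^sup>L content_measure h + 2 * B / real M) sequentially"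
    by (auto intro: eventually_mono[OF eventually_gt_at_top[of 0]])
  have "(\<lambda>M. integral\<^sup>L content_measure h + 2 * B / real M)
      \<longlonglongrightarrow> integral\<^sup>L content_measure h"
    using tendsto_add[OF tendsto_const[of "integral\<^sup>L content_measure h"] lim_const_over_n[of "2 * B"]]
    by simp
  from tendsto_lowerbound[OF this ev] show ?thesis by simp
qed

theorem uniquely_ergodic_birkhoff:
  fixes T :: "'a::metric_space \<Rightarrow> 'a" and h :: "'a \<Rightarrow> real"
  assumes cpt: "compact (UNIV :: 'a set)"
    and T: "bij T" "continuous_on UNIV T" "continuous_on UNIV (inv_into UNIV T)"
    and ue: "uniquely_ergodic T \<nu>"
    and h: "continuous_on UNIV h"
  shows "birkhoff_avg T h \<omega> \<longlonglongrightarrow> integral\<^sup>L \<nu> h"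
proof (rule ccontr)
  assume "\<not> ?thesis"
  then obtain e where e: "0 < e"
    "\<not> eventually (\<lambda>n. dist (birkhoff_avg T h \<omega> n) (integral\<^sup>L \<nu> h) < e) sequentially"
    unfolding tendsto_iff by blast
  \<comment> \<open>The late times at which the average misses the integral by at least
    \<open>e\<close>; failure of convergence makes this a proper filter.\<close>
  define F where "F = inf sequentially (principal {n. e \<le> dist (birkhoff_avg T h \<omega> n) (integral\<^sup>L \<nu> h)})"
  have "F \<noteq> bot"
    using e(2) unfolding F_def trivial_limit_def eventually_inf_principal by (simp add: not_le)
  obtain B where B: "0 < B" "\<And>\<omega>. \<bar>h \<omega>\<bar> \<le> B"
    using compact_imp_bounded[OF compact_continuous_image[OF h cpt]] by (auto simp: bounded_pos)
  \<comment> \<open>The index set consists of all functions, so those violating the bound are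
    replaced by 0 to keep every average in one compact interval. The bound \<open>B + 1\<close>
    admits \<open>h\<close> and all indicators, which therefore converge along the same
    filter.\<close>
  define X where "X n g = birkhoff_avg T (if \<forall>x. \<bar>g x\<bar> \<le> B + 1 then g else (\<lambda>_. 0)) \<omega> n" for n g
  have bnd: "\<bar>birkhoff_avg T g \<omega> n\<bar> \<le> B + 1" if "\<forall>x. \<bar>g x\<bar> \<le> B + 1" for g n
  proof (cases "n = 0")
    case False
    then show ?thesis
      using birkhoff_avg_mono[of g "\<lambda>_. B + 1" T \<omega> n] birkhoff_avg_mono[of "\<lambda>_. - (B + 1)" g T \<omega> n] that B
      by (simp add: birkhoff_avg_const abs_le_iff) (smt (verit))
  qed (use B in \<open>simp add: birkhoff_avg_def\<close>)
  have "X n g \<in> {- (B + 1)..B + 1}" for n g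
  proof -
    have "\<forall>x. \<bar>(if \<forall>x. \<bar>g x\<bar> \<le> B + 1 then g else (\<lambda>_. 0)) x\<bar> \<le> B + 1" using B(1) by auto
    then have "\<bar>X n g\<bar> \<le> B + 1" unfolding X_def by (rule bnd)
    then show ?thesis by (simp add: abs_le_iff)
  qed
  from pointwise_convergent_subfilter[of F X, OF \<open>F \<noteq> bot\<close> this]
  obtain G L where G: "G \<noteq> bot" "G \<le> F" and L: "\<And>g. ((\<lambda>n. X n g) \<longlongrightarrow> L g) G" by blast
  have lim: "(birkhoff_avg T g \<omega> \<longlongrightarrow> L g) G" if "\<And>x. \<bar>g x\<bar> \<le> B + 1" for g
    using L[of g] that unfolding X_def by simp
  define m where "m A = L (indicator A)" for A
  have limm: "(birkhoff_avg T (indicator A) \<omega> \<longlongrightarrow> m A) G" for A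
    unfolding m_def using B by (intro lim) (auto simp: indicator_def)
  have Gs: "G \<le> sequentially" using G(2) unfolding F_def by simp
  interpret finite_content m by (rule birkhoff_avg_indicator_limit[OF cpt G(1) Gs limm])
  have minv: "m (T -` A) = m A" for A by (rule birkhoff_avg_indicator_limit[OF cpt G(1) Gs limm])
  have Tm: "T \<in> measurable content_measure content_measure"
    using borel_measurable_continuous_onI[OF T(2)] sets_content_measure measurable_cong_sets by blast
  have "invariant_borel_prob T content_measure"
    unfolding invariant_borel_prob_def
    using sets_content_measure prob_space_content_measure Tm distr_content_measure[OF T minv] by simp
  then have nu: "content_measure = \<nu>" using ue by (auto simp: uniquely_ergodic_def)
  have hL: "(birkhoff_avg T h \<omega> \<longlongrightarrow> L h) G" using B by (intro lim) (simp add: add_increasing2)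
  have "birkhoff_avg T (\<lambda>x. - h x) \<omega> = (\<lambda>n. - birkhoff_avg T h \<omega> n)"
    by (simp add: birkhoff_avg_def fun_eq_iff sum_negf)
  then have "(birkhoff_avg T (\<lambda>x. - h x) \<omega> \<longlongrightarrow> - L h) G" using tendsto_minus[OF hL] by simp
  \<comment> \<open>The one-sided estimate for \<open>-h\<close> yields the reverse inequality for
    \<open>h\<close>.\<close>
  then have "- L h \<le> integral\<^sup>L content_measure (\<lambda>x. - h x)"
    by (rule birkhoff_limit_le_integral[OF continuous_on_minus[OF h] G(1) Gs limm])
  moreover have "L h \<le> integral\<^sup>L \<nu> h"
    using birkhoff_limit_le_integral[OF h G(1) Gs limm hL] nu by simp
  ultimately have "L h = integral\<^sup>L \<nu> h" using nu by simp
  then have "eventually (\<lambda>n. dist (birkhoff_avg T h \<omega> n) (integral\<^sup>L \<nu> h) < e) G"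
    using tendstoD[OF hL e(1)] by simp
  moreover have "eventually (\<lambda>n. e \<le> dist (birkhoff_avg T h \<omega> n) (integral\<^sup>L \<nu> h)) G"
    by (rule filter_leD[OF G(2)]) (simp add: F_def eventually_inf_principal)
  ultimately have "eventually (\<lambda>_. False) G" by eventually_elim simp
  then show False using G(1) by (simp add: trivial_limit_def)
qed

section \<open>The lifted projective action\<close>

text \<open>The device behind the identities for the lift: comparing sines and cosines proves them
  modulo integers, and by connectedness one point decides the integer.\<close>

lemma Ints_valued_continuous_constant:
  fixes f :: "'b::real_normed_vector \<Rightarrow> real"
  assumes "continuous_on UNIV f" "\<And>x. f x \<in> \<int>"
  shows "f x = f y"
proof -
  have "f constant_on UNIV"
  proof (rule continuous_discrete_range_constant[OF connected_UNIV assms(1)])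
    fix x :: 'b
    show "\<exists>e>0. \<forall>y. y \<in> UNIV \<and> f y \<noteq> f x \<longrightarrow> e \<le> norm (f y - f x)"
      using assms(2) by (intro exI[of _ 1]) (auto elim!: Ints_cases simp: Ints_nonzero_abs_ge1
          intro!: Ints_nonzero_abs_ge1)
  qed
  then show ?thesis by (auto simp: constant_on_def)
qed

lemma Ints_of_equal_angle:
  assumes "cos (2 * pi * x) = cos (2 * pi * y)" "sin (2 * pi * x) = sin (2 * pi * y)"
  shows "x - y \<in> \<int>"
proof -
  obtain n :: int where "2 * pi * x = 2 * pi * y + 2 * pi * n"
    using assms sin_cos_eq_iff by metis
  then have "2 * pi * (x - y - of_int n) = 0" by (simp add: algebra_simps)
  then show ?thesis by (auto simp: Ints_def)
qed

text \<open>Length of the image of the unit vector at angle \<open>2*pi*t\<close> under the matrix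
  \<open>[[a,-1],[1,0]]\<close>.\<close>

definition schr_norm :: "real \<Rightarrow> real \<Rightarrow> real" where
  "schr_norm a t = sqrt ((a * cos (2*pi*t) - sin (2*pi*t))\<^sup>2 + (cos (2*pi*t))\<^sup>2)"

lemma schr_norm_pos: "0 < schr_norm a t"
proof (cases "cos (2*pi*t) = 0")
  case True
  then have "sin (2*pi*t) \<noteq> 0" by (metis sin_zero_norm_cos_one norm_zero zero_neq_one)
  then show ?thesis using True by (simp add: schr_norm_def)
next
  case False
  then show ?thesis unfolding schr_norm_def by (simp add: add_nonneg_pos)
qed

lemma schr_lift_ok_iff:
  "schr_lift_ok \<Phi> \<longleftrightarrow> continuous_on UNIV (\<lambda>(a,t). \<Phi> a t) \<and> \<Phi> 0 0 = 1/4 \<and>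
     (\<forall>a t. cos (2*pi*\<Phi> a t) * schr_norm a t = a * cos (2*pi*t) - sin (2*pi*t) \<and>
            sin (2*pi*\<Phi> a t) * schr_norm a t = cos (2*pi*t))"
  unfolding schr_lift_ok_def schr_norm_def Let_def ..

lemma schr_lift_ok_unique:
  assumes "schr_lift_ok \<Phi>" "schr_lift_ok \<Psi>"
  shows "\<Phi> = \<Psi>"
proof -
  define D where "D = (\<lambda>p. (case p of (a,t) \<Rightarrow> \<Phi> a t) - (case p of (a,t) \<Rightarrow> \<Psi> a t))"
  have c: "continuous_on UNIV D"
    unfolding D_def using assms by (intro continuous_on_diff) (auto simp: schr_lift_ok_iff)
  have i: "D p \<in> \<int>" for p
  proof (cases p)
    case (Pair a t)
    have "cos (2*pi*\<Phi> a t) * schr_norm a t = cos (2*pi*\<Psi> a t) * schr_norm a t"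
      "sin (2*pi*\<Phi> a t) * schr_norm a t = sin (2*pi*\<Psi> a t) * schr_norm a t"
      using assms unfolding schr_lift_ok_iff by metis+
    then have "\<Phi> a t - \<Psi> a t \<in> \<int>"
      using schr_norm_pos[of a t] by (intro Ints_of_equal_angle) auto
    then show ?thesis by (simp add: Pair D_def)
  qed
  have "D (0,0) = 0" using assms by (simp add: D_def schr_lift_ok_iff)
  then have "D (a,t) = 0" for a t
    using Ints_valued_continuous_constant[OF c i, of "(a,t)" "(0,0)"] by simp
  then show ?thesis by (auto simp: D_def fun_eq_iff)
qed

text \<open>The image vector, read as a complex number, never vanishes and depends continuously on a
  point of the contractible plane. It thus has a continuous logarithm, whose imaginary part is an
  angle; an integer shift arranges the normalization.\<close>

lemma schr_lift_ok_exists: "\<exists>\<Phi>. schr_lift_ok \<Phi>"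
proof -
  define F where "F = (\<lambda>p::real\<times>real. Complex (fst p * cos (2*pi * snd p) - sin (2*pi * snd p)) (cos (2*pi * snd p)))"
  have nF: "norm (F (a,t)) = schr_norm a t" for a t
    by (simp add: F_def schr_norm_def cmod_def)
  have nz: "F p \<noteq> 0" for p
    using nF[of "fst p" "snd p"] schr_norm_pos[of "fst p" "snd p"] by force
  have "continuous_on UNIV F" unfolding F_def by (intro continuous_intros)
  then obtain g where g: "continuous_on UNIV g" "\<And>p. F p = exp (g p)"
    using continuous_logarithm_on_contractible[of UNIV F] nz convex_imp_contractible[OF convex_UNIV] by auto
  define \<psi> where "\<psi> a t = Im (g (a,t)) / (2*pi)" for a t
  have angle: "cos (2*pi*\<psi> a t) * schr_norm a t = a * cos (2*pi*t) - sin (2*pi*t)"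
    "sin (2*pi*\<psi> a t) * schr_norm a t = cos (2*pi*t)" for a t
    using arg_cong[OF g(2)[of "(a,t)"], of Re] arg_cong[OF g(2)[of "(a,t)"], of Im]
      nF[of a t] g(2)[of "(a,t)"]
    by (simp_all add: \<psi>_def F_def Re_exp Im_exp mult.commute)
  have "\<psi> 0 0 - 1/4 \<in> \<int>"
    by (rule Ints_of_equal_angle) (use angle[of 0 0] in \<open>simp_all add: schr_norm_def\<close>)
  then obtain k :: int where k: "\<psi> 0 0 = 1/4 + of_int k" by (auto elim!: Ints_cases simp: algebra_simps)
  define \<Phi> where "\<Phi> a t = \<psi> a t - of_int k" for a t
  have sh: "cos (2*pi*\<Phi> a t) = cos (2*pi*\<psi> a t)" "sin (2*pi*\<Phi> a t) = sin (2*pi*\<psi> a t)" for a t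
    using sin_cos_eq_iff[of "2*pi*\<psi> a t" "2*pi*\<Phi> a t"]
    by (auto simp: \<Phi>_def algebra_simps intro!: exI[of _ k])
  have "(\<lambda>(a,t). \<Phi> a t) = (\<lambda>p. Im (g p) / (2*pi) - of_int k)"
    by (auto simp: \<Phi>_def \<psi>_def)
  then have c: "continuous_on UNIV (\<lambda>(a,t). \<Phi> a t)"
    using g(1) by (auto intro!: continuous_intros)
  have "schr_lift_ok \<Phi>"
    unfolding schr_lift_ok_iff sh using angle k by (intro conjI c allI) (simp_all add: \<Phi>_def)
  then show ?thesis by blast
qed

lemma schr_lift_ok: "schr_lift_ok schr_lift"
  unfolding schr_lift_def using schr_lift_ok_exists schr_lift_ok_unique by (metis theI)

lemma schr_lift_cos: "cos (2*pi * schr_lift a t) * schr_norm a t = a * cos (2*pi*t) - sin (2*pi*t)"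
  and schr_lift_sin: "sin (2*pi * schr_lift a t) * schr_norm a t = cos (2*pi*t)"
  using schr_lift_ok by (auto simp: schr_lift_ok_iff)

lemma continuous_on_schr_lift [continuous_intros]:
  assumes "continuous_on S f" "continuous_on S g"
  shows "continuous_on S (\<lambda>x. schr_lift (f x) (g x))"
proof -
  have "continuous_on UNIV (\<lambda>(a,t). schr_lift a t)" using schr_lift_ok by (simp add: schr_lift_ok_iff)
  then have "continuous_on S ((\<lambda>(a,t). schr_lift a t) \<circ> (\<lambda>x. (f x, g x)))"
    using assms by (intro continuous_on_compose continuous_on_Pair) (auto intro: continuous_on_subset)
  then show ?thesis by (simp add: comp_def)
qed

section \<open>Special values and symmetries of the lift\<close>

lemma schr_lift_zero: "schr_lift 0 t = t + 1/4"
proof -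
  have "schr_lift 0 t - (t + 1/4) \<in> \<int>" for t
    by (rule Ints_of_equal_angle)
       (use schr_lift_cos[of 0 t] schr_lift_sin[of 0 t] in
         \<open>simp_all add: schr_norm_def distrib_left cos_add sin_add\<close>)
  moreover have "continuous_on UNIV (\<lambda>t. schr_lift 0 t - (t + 1/4))" by (intro continuous_intros)
  ultimately have "schr_lift 0 t - (t + 1/4) = schr_lift 0 0 - (0 + 1/4)"
    using Ints_valued_continuous_constant[of "\<lambda>t. schr_lift 0 t - (t + 1/4)" t 0] by simp
  then show ?thesis using schr_lift_ok by (simp add: schr_lift_ok_iff)
qed

text \<open>By linearity \<open>-v\<close> goes to the negative of the image of \<open>v\<close>, so
  the lift commutes with half turns and not only with full ones.\<close>

lemma schr_lift_half: "schr_lift a (t + 1/2) = schr_lift a t + 1/2"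
proof -
  have "schr_lift a (t + 1/2) - (schr_lift a t + 1/2) \<in> \<int>" for a t
  proof -
    have n: "schr_norm a (t + 1/2) = schr_norm a t"
      by (simp add: schr_norm_def distrib_left power2_eq_square algebra_simps)
    show ?thesis
      by (rule Ints_of_equal_angle)
        (use schr_lift_cos[of a "t+1/2"] schr_lift_sin[of a "t+1/2"] schr_lift_cos[of a t] schr_lift_sin[of a t]
          schr_norm_pos[of a t] in \<open>auto simp: n distrib_left intro: mult_right_cancel[THEN iffD1, of "schr_norm a t"]\<close>)
  qed
  moreover have "continuous_on UNIV (\<lambda>p. schr_lift (fst p) (snd p + 1/2) - (schr_lift (fst p) (snd p) + 1/2))"
    by (intro continuous_intros)
  ultimately show ?thesis
    using Ints_valued_continuous_constant
      [of "\<lambda>p. schr_lift (fst p) (snd p + 1/2) - (schr_lift (fst p) (snd p) + 1/2)" "(a,t)" "(0,0)"]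
    by (simp add: schr_lift_zero)
qed

lemma schr_lift_half_int: "schr_lift a (t + of_int k / 2) = schr_lift a t + of_int k / 2"
proof (induction k rule: int_induct[of _ 0])
  case (step1 i)
  then show ?case using schr_lift_half[of a "t + of_int i / 2"] by (simp add: add_divide_distrib add.assoc)
next
  case (step2 i)
  then show ?case using schr_lift_half[of a "t + of_int (i - 1) / 2"]
    by (simp add: diff_divide_distrib add_divide_distrib)
qed simp

text \<open>The vector \<open>(0,1)\<close> is sent to \<open>(-1,0)\<close> whatever
  \<open>a\<close> is. These pinned values confine the lift between consecutive vertical
  directions.\<close>

lemma schr_lift_quarter: "schr_lift a (1/4) = 1/2"
proof -
  have "schr_lift a (1/4) - 1/2 \<in> \<int>" for a
    by (rule Ints_of_equal_angle)
       (use schr_lift_cos[of a "1/4"] schr_lift_sin[of a "1/4"] in \<open>simp_all add: schr_norm_def\<close>)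
  moreover have "continuous_on UNIV (\<lambda>a. schr_lift a (1/4) - 1/2)" by (intro continuous_intros)
  ultimately show ?thesis
    using Ints_valued_continuous_constant[of "\<lambda>a. schr_lift a (1/4) - 1/2" a 0]
    by (simp add: schr_lift_zero)
qed

lemma schr_lift_neg_quarter: "schr_lift a (-1/4) = 0"
  using schr_lift_half[of a "-1/4"] schr_lift_quarter[of a] by simp

section \<open>Monotonicity in the angle\<close>

lemma schr_lift_sin_diff:
  "sin (2*pi*(schr_lift a t' - schr_lift a t)) * (schr_norm a t' * schr_norm a t) = sin (2*pi*(t' - t))"
proof -
  \<comment> \<open>This is the cross product of the two image vectors; since the matrix has
    determinant 1, it equals that of the original unit vectors.\<close>
  have "sin (2*pi*(schr_lift a t' - schr_lift a t)) * (schr_norm a t' * schr_norm a t) =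
     (sin (2*pi * schr_lift a t') * schr_norm a t') * (cos (2*pi * schr_lift a t) * schr_norm a t)
     - (cos (2*pi * schr_lift a t') * schr_norm a t') * (sin (2*pi * schr_lift a t) * schr_norm a t)"
    by (simp add: right_diff_distrib sin_diff algebra_simps)
  also have "\<dots> = sin (2*pi*(t' - t))"
    unfolding schr_lift_cos schr_lift_sin by (simp add: right_diff_distrib sin_diff algebra_simps)
  finally show ?thesis .
qed

lemma schr_lift_inj: "inj (schr_lift a)"
proof (rule injI)
  fix t t' assume eq: "schr_lift a t = schr_lift a t'"
  then have "sin (2*pi*(t' - t)) = 0" using schr_lift_sin_diff[of a t' t] by simp
  then obtain k :: int where "2*pi*(t' - t) = of_int k * pi" by (auto simp: sin_zero_iff_int2)
  then have "pi * (2*(t' - t) - of_int k) = 0" by (simp add: algebra_simps)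
  then have k: "t' = t + of_int k / 2" by simp
  then have "of_int k / (2::real) = 0" using eq schr_lift_half_int[of a t k] by simp
  then show "t = t'" using k by simp
qed

lemma schr_lift_strict_mono: "t < t' \<Longrightarrow> schr_lift a t < schr_lift a t'"
proof -
  assume t: "t < t'"
  \<comment> \<open>A continuous injection of an interval is monotone; the far endpoint,
    \<open>K\<close> half turns beyond \<open>t\<close>, has a known larger image and settles the
    direction.\<close>
  obtain K :: nat where K: "2 * (t' - t) < real K" using reals_Archimedean2 by blast
  let ?b = "t + of_int (int K) / 2"
  have b: "t' < ?b" "schr_lift a ?b > schr_lift a t"
    unfolding schr_lift_half_int using K t by simp_all
  have "continuous_on {t..?b} (schr_lift a)" by (intro continuous_intros)
  moreover have "inj_on (schr_lift a) {t..?b}" by (rule inj_on_subset[OF schr_lift_inj]) simp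
  ultimately have "schr_lift a t < schr_lift a t' \<and> schr_lift a t' < schr_lift a ?b
      \<or> schr_lift a ?b < schr_lift a t' \<and> schr_lift a t' < schr_lift a t"
    by (rule continuous_inj_imp_mono[OF t b(1)])
  then show ?thesis using b(2) by linarith
qed

lemma schr_lift_mono: "t \<le> t' \<Longrightarrow> schr_lift a t \<le> schr_lift a t'"
  using schr_lift_strict_mono[of t t' a] by (cases "t = t'") auto

text \<open>Together with \<open>schr_lift_half_int\<close> this reduces claims about the lift to
  one interval between vertical directions.\<close>

lemma half_integer_shift:
  fixes t :: real
  obtains k :: int and s where "t = s + of_int k / 2" "-1/4 < s" "s \<le> 1/4"
proof -
  let ?k = "\<lceil>2*t - 1/2\<rceil>"
  have "t = (t - of_int ?k / 2) + of_int ?k / 2" "-1/4 < t - of_int ?k / 2" "t - of_int ?k / 2 \<le> 1/4"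
    by linarith+
  then show thesis by (rule that)
qed

lemma schr_lift_range:
  assumes "-1/4 < t" "t \<le> 1/4" shows "0 < schr_lift a t" "schr_lift a t \<le> 1/2"
  using schr_lift_strict_mono[OF assms(1), of a] schr_lift_mono[OF assms(2), of a]
    schr_lift_neg_quarter[of a] schr_lift_quarter[of a] by simp_all

lemma schr_lift_displacement: "\<bar>schr_lift a t - t\<bar> \<le> 1"
proof -
  obtain k s where ks: "t = s + of_int k / 2" "-1/4 < s" "s \<le> 1/4" by (rule half_integer_shift)
  show ?thesis
    unfolding ks(1) schr_lift_half_int using schr_lift_range[OF ks(2,3), of a] ks(2,3) by linarith
qed

section \<open>Monotonicity in the parameter\<close>

lemma schr_lift_strict_antimono_parameter:
  assumes t: "-1/4 < t" "t < 1/4" and a: "a < a'"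
  shows "schr_lift a' t < schr_lift a t"
proof -
  have c: "0 < cos (2*pi*t)"
    using mult_strict_left_mono[of t "1/4" "2*pi"] mult_strict_left_mono[of "-1/4" t "2*pi"] t
    by (intro cos_gt_zero_pi) simp_all
  have "sin (2*pi*(schr_lift a' t - schr_lift a t)) * (schr_norm a' t * schr_norm a t) =
     (sin (2*pi * schr_lift a' t) * schr_norm a' t) * (cos (2*pi * schr_lift a t) * schr_norm a t)
     - (cos (2*pi * schr_lift a' t) * schr_norm a' t) * (sin (2*pi * schr_lift a t) * schr_norm a t)"
    by (simp add: right_diff_distrib sin_diff algebra_simps)
  \<comment> \<open>The images under the two matrices differ only in the first coordinate, by
    \<open>(a' - a) * cos (2*pi*t)\<close>; the effect is strict because the vector is not
    vertical.\<close>
  also have "\<dots> = - ((a' - a) * (cos (2*pi*t))\<^sup>2)"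
    unfolding schr_lift_cos schr_lift_sin by (simp add: power2_eq_square algebra_simps)
  also have "\<dots> < 0" using a c by simp
  finally have neg: "sin (2*pi*(schr_lift a' t - schr_lift a t)) < 0"
    using schr_norm_pos[of a' t] schr_norm_pos[of a t] by (simp add: mult_less_0_iff not_less)
  \<comment> \<open>Both images lie in \<open>(0, 1/2]\<close>, so the sign of the sine determines
    the sign of the difference.\<close>
  have "schr_lift a' t - schr_lift a t < 1/2"
    using schr_lift_range[of t a] schr_lift_range[of t a'] t by simp
  show ?thesis
  proof (rule ccontr)
    assume "\<not> ?thesis"
    then have "0 \<le> 2*pi*(schr_lift a' t - schr_lift a t)" by simp
    moreover have "2*pi*(schr_lift a' t - schr_lift a t) \<le> pi"
      using mult_left_mono[of "schr_lift a' t - schr_lift a t" "1/2" "2*pi"]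
        \<open>schr_lift a' t - schr_lift a t < 1/2\<close> by simp
    ultimately have "0 \<le> sin (2*pi*(schr_lift a' t - schr_lift a t))" by (rule sin_ge_zero)
    then show False using neg by simp
  qed
qed

lemma schr_lift_antimono_parameter:
  assumes "a \<le> a'" shows "schr_lift a' t \<le> schr_lift a t"
proof -
  obtain k s where ks: "t = s + of_int k / 2" "-1/4 < s" "s \<le> 1/4" by (rule half_integer_shift)
  have "schr_lift a' s \<le> schr_lift a s"
  proof (cases "s = 1/4 \<or> a = a'")
    case True
    then show ?thesis using schr_lift_quarter[of a] schr_lift_quarter[of a'] by fastforce
  next
    case False
    then show ?thesis
      using assms ks(2,3) schr_lift_strict_antimono_parameter[of s a a'] by simp
  qed
  then show ?thesis using schr_lift_half_int[of a s k] schr_lift_half_int[of a' s k] ks by simp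
qed

section \<open>Cones for parameters of absolute value at least 2\<close>

lemma schr_lift_two: "schr_lift 2 (1/8) = 1/8"
proof -
  \<comment> \<open>The parabolic matrix \<open>[[2,-1],[1,0]]\<close> fixes \<open>(1,1)\<close>,
    which points at angle 1/8; the range of the lift removes the integer ambiguity.\<close>
  have "2 * pi * (1/8) = pi / 4" by simp
  then have "schr_lift 2 (1/8) - 1/8 \<in> \<int>"
    by (intro Ints_of_equal_angle)
      (use schr_lift_cos[of 2 "1/8"] schr_lift_sin[of 2 "1/8"] in
        \<open>simp_all add: schr_norm_def cos_45 sin_45 power2_eq_square\<close>)
  then show ?thesis using schr_lift_range[of "1/8" 2]
      Ints_nonzero_abs_less1[of "schr_lift 2 (1/8) - 1/8"] by (simp add: abs_less_iff)
qed

lemma schr_lift_neg_two: "schr_lift (-2) (-1/8) = 3/8"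
proof -
  \<comment> \<open>The matrix \<open>[[-2,-1],[1,0]]\<close> sends \<open>(1,-1)\<close> to its
    negative, from angle -1/8 to 3/8.\<close>
  have "cos (3 * pi / 4) = - (sqrt 2 / 2)" "sin (3 * pi / 4) = sqrt 2 / 2"
    using cos_add[of "pi/2" "pi/4"] sin_add[of "pi/2" "pi/4"] by (simp_all add: cos_45 sin_45)
  then have "schr_lift (-2) (-1/8) - 3/8 \<in> \<int>"
    by (intro Ints_of_equal_angle)
      (use schr_lift_cos[of "-2" "-1/8"] schr_lift_sin[of "-2" "-1/8"] in
        \<open>simp_all add: schr_norm_def cos_45 sin_45 power2_eq_square cos_add sin_add\<close>)
  then show ?thesis using schr_lift_range[of "-1/8" "-2"]
      Ints_nonzero_abs_less1[of "schr_lift (-2) (-1/8) - 3/8"] by (simp add: abs_less_iff)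
qed

lemma schr_lift_cone_pos:
  assumes "2 \<le> a" "0 \<le> t" "t \<le> 1/8"
  shows "0 \<le> schr_lift a t" "schr_lift a t \<le> 1/8"
  using schr_lift_range[of t a] schr_lift_mono[of t "1/8" a] schr_lift_antimono_parameter[of 2 a "1/8"]
    schr_lift_two assms by simp_all

text \<open>For \<open>a \<le> -2\<close> the cone between -1/8 and 0 is mapped into its own half
  turn, so each step moves the confining interval by exactly 1/2.\<close>

lemma schr_lift_cone_neg:
  assumes "a \<le> -2" "real n / 2 - 1/8 \<le> t" "t \<le> real n / 2"
  shows "real (Suc n) / 2 - 1/8 \<le> schr_lift a t" "schr_lift a t \<le> real (Suc n) / 2"
proof -
  define s where "s = t - of_int (int n) / 2"
  have s: "t = s + of_int (int n) / 2" "-1/8 \<le> s" "s \<le> 0" using assms by (simp_all add: s_def)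
  have "3/8 \<le> schr_lift a s" "schr_lift a s \<le> 1/2"
    using schr_lift_range[of s a] schr_lift_mono[of "-1/8" s a] schr_lift_antimono_parameter[of a "-2" "-1/8"]
    schr_lift_neg_two assms(1) s by simp_all
  then show "real (Suc n) / 2 - 1/8 \<le> schr_lift a t" "schr_lift a t \<le> real (Suc n) / 2"
    using schr_lift_half_int[of a s "int n"] s(1) by (simp_all add: add_divide_distrib)
qed

section \<open>Iterates of the lift along an orbit\<close>

lemma lift_iter_mono: "t \<le> t' \<Longrightarrow> lift_iter T a n \<omega> t \<le> lift_iter T a n \<omega> t'"
  by (induction n) (auto intro: schr_lift_mono)

lemma lift_iter_shift_int: "lift_iter T a n \<omega> (t + of_int k) = lift_iter T a n \<omega> t + of_int k"
proof (induction n)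
  case (Suc n)
  then show ?case
    using schr_lift_half_int[of "a ((T ^^ n) \<omega>)" "lift_iter T a n \<omega> t" "2 * k"] by simp
qed simp

lemma lift_iter_add:
  "lift_iter T a (n + k) \<omega> t = lift_iter T a k ((T ^^ n) \<omega>) (lift_iter T a n \<omega> t)"
  by (induction k) (simp_all add: funpow_add add.commute[of n])

lemma lift_iter_displacement: "\<bar>lift_iter T a n \<omega> t - t\<bar> \<le> real n"
proof (induction n)
  case (Suc n)
  then show ?case using schr_lift_displacement[of "a ((T ^^ n) \<omega>)" "lift_iter T a n \<omega> t"] by simp
qed simp

text \<open>The reason is that the lift is monotone and commutes with integer translations.\<close>
lemma lift_iter_base_point:
  "\<bar>lift_iter T a n \<omega> t - t - lift_iter T a n \<omega> 0\<bar> \<le> 1"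
proof -
  have "lift_iter T a n \<omega> (0 + of_int \<lfloor>t\<rfloor>) \<le> lift_iter T a n \<omega> t"
    "lift_iter T a n \<omega> t \<le> lift_iter T a n \<omega> (0 + of_int (\<lfloor>t\<rfloor> + 1))"
    by (rule lift_iter_mono; linarith)+
  then show ?thesis unfolding lift_iter_shift_int by linarith
qed

lemma continuous_on_funpow:
  fixes T :: "'a::topological_space \<Rightarrow> 'a"
  shows "continuous_on UNIV T \<Longrightarrow> continuous_on UNIV (T ^^ n)"
  by (induction n) (auto intro: continuous_on_compose2)

lemma continuous_on_lift_iter:
  assumes "continuous_on UNIV T" "continuous_on UNIV a"
  shows "continuous_on UNIV (\<lambda>\<omega>. lift_iter T a n \<omega> t)"
proof (induction n)
  case (Suc n)
  have "continuous_on UNIV (a \<circ> (T ^^ n))"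
    using assms by (intro continuous_on_compose continuous_on_funpow) (auto intro: continuous_on_subset)
  then show ?case using Suc by (auto simp: comp_def intro!: continuous_intros)
qed simp

section \<open>Truncated block Jacobi matrices\<close>

unbundle no vec_syntax

section \<open>Eigenvalue multiplicities of self-adjoint matrices\<close>

lemma order_linear_factors:
  "Polynomial.order x (\<Prod>a\<leftarrow>as. [:- a, 1:] :: complex poly) = count_list as x"
proof (induction as)
  case (Cons a as)
  have nz: "(\<Prod>a\<leftarrow>as. [:- a, 1:] :: complex poly) \<noteq> 0" by (auto simp: prod_list_zero_iff)
  show ?case
  proof (cases "a = x")
    case True
    then show ?thesis
      using Cons nz order_power_n_n[of x 1] by (simp del: mult_pCons_left add: order_mult)
  next
    case False
    then show ?thesis using Cons nz by (simp del: mult_pCons_left add: order_mult order_0I)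
  qed
qed simp

text \<open>Knowing the total multiplicity allows the eigenvalues up to \<open>E\<close> to be
  counted through those above \<open>E\<close>.\<close>

lemma sum_order_char_poly:
  fixes A :: "complex mat"
  assumes A: "A \<in> carrier_mat n n"
  shows "finite {x. poly (char_poly A) x = 0}"
    and "(\<Sum>x | poly (char_poly A) x = 0. Polynomial.order x (char_poly A)) = n"
proof -
  obtain as where as: "char_poly A = (\<Prod>a\<leftarrow>as. [:- a, 1:])" "length as = n"
    using char_poly_factorized[OF A] by blast
  have roots: "{x. poly (char_poly A) x = 0} = set as"
    unfolding as(1) by (auto simp: poly_prod_list prod_list_zero_iff)
  then show "finite {x. poly (char_poly A) x = 0}" by simp
  show "(\<Sum>x | poly (char_poly A) x = 0. Polynomial.order x (char_poly A)) = n"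
    unfolding roots unfolding as(1) order_linear_factors by (simp add: sum_count_set as(2))
qed

lemma hermitian_scalar_prod:
  fixes A :: "complex mat"
  assumes A: "A \<in> carrier_mat n n" and herm: "\<And>i j. i < n \<Longrightarrow> j < n \<Longrightarrow> A $$ (i,j) = cnj (A $$ (j,i))"
    and v: "v \<in> carrier_vec n" and w: "w \<in> carrier_vec n"
  shows "(A *\<^sub>v v) \<bullet>c w = v \<bullet>c (A *\<^sub>v w)"
proof -
  have "(A *\<^sub>v v) \<bullet>c w = (\<Sum>i<n. \<Sum>j<n. A $$ (i,j) * v $ j * cnj (w $ i))"
    using A v w by (simp add: scalar_prod_def sum_distrib_right lessThan_atLeast0)
  also have "\<dots> = (\<Sum>j<n. \<Sum>i<n. A $$ (i,j) * v $ j * cnj (w $ i))" by (rule sum.swap)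
  also have "\<dots> = (\<Sum>j<n. \<Sum>i<n. v $ j * cnj (A $$ (j,i) * w $ i))"
    by (intro sum.cong refl) (simp add: herm[of _ _, symmetric] mult_ac)
  also have "\<dots> = v \<bullet>c (A *\<^sub>v w)"
    using A v w by (simp add: scalar_prod_def sum_distrib_left lessThan_atLeast0)
  finally show ?thesis .
qed

lemma hermitian_char_poly_root_real:
  fixes A :: "complex mat"
  assumes A: "A \<in> carrier_mat n n" and herm: "\<And>i j. i < n \<Longrightarrow> j < n \<Longrightarrow> A $$ (i,j) = cnj (A $$ (j,i))"
    and root: "poly (char_poly A) k = 0"
  shows "Im k = 0"
proof -
  obtain v where v: "v \<in> carrier_vec n" "v \<noteq> 0\<^sub>v n" "A *\<^sub>v v = k \<cdot>\<^sub>v v"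
    using root A unfolding eigenvalue_root_char_poly[OF A, symmetric] eigenvalue_def eigenvector_def by auto
  have "k * (v \<bullet>c v) = cnj k * (v \<bullet>c v)"
    using hermitian_scalar_prod[OF A herm v(1) v(1)] v by (simp add: conjugate_smult_vec)
  moreover have "v \<bullet>c v \<noteq> 0" using conjugate_square_eq_0_vec[OF v(1)] v(2) by simp
  ultimately have "k = cnj k" by simp
  then show ?thesis by (simp add: complex_eq_iff)
qed

text \<open>Self-adjoint matrices have no Jordan chains of length two: moving \<open>A\<close>
  across the inner product of \<open>p\<close> and \<open>w\<close> leaves
  \<open>w \<bullet>c w = 0\<close>.\<close>

lemma hermitian_generalized_eigenvector:
  fixes A :: "complex mat"
  assumes A: "A \<in> carrier_mat n n" and herm: "\<And>i j. i < n \<Longrightarrow> j < n \<Longrightarrow> A $$ (i,j) = cnj (A $$ (j,i))"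
    and p: "p \<in> carrier_vec n" and w: "w \<in> carrier_vec n"
    and Ap: "A *\<^sub>v p = complex_of_real x \<cdot>\<^sub>v p + w" and Aw: "A *\<^sub>v w = complex_of_real x \<cdot>\<^sub>v w"
  shows "w = 0\<^sub>v n"
proof -
  have "(A *\<^sub>v p) \<bullet>c w = complex_of_real x * (p \<bullet>c w) + w \<bullet>c w"
    unfolding Ap using p w by (simp add: add_scalar_prod_distrib[of _ n])
  moreover have "p \<bullet>c (A *\<^sub>v w) = complex_of_real x * (p \<bullet>c w)"
    unfolding Aw using p w by (simp add: conjugate_smult_vec)
  ultimately have "w \<bullet>c w = 0" using hermitian_scalar_prod[OF A herm p w] by simp
  then show ?thesis using conjugate_square_eq_0_vec[OF w] by simp
qed

lemma mult_mat_unit_vec: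
  fixes B :: "complex mat"
  assumes "B \<in> carrier_mat n n" "j < n"
  shows "B *\<^sub>v unit_vec n j = col B j"
  using assms by (intro eq_vecI) (auto simp: scalar_prod_right_unit)

text \<open>A double root provides, via the Schur form, two independent eigenvectors; a combination of them
  vanishes in the first coordinate.\<close>
lemma hermitian_double_root_eigenvector:
  fixes A :: "complex mat" and x :: real
  assumes A: "A \<in> carrier_mat n n" and herm: "\<And>i j. i < n \<Longrightarrow> j < n \<Longrightarrow> A $$ (i,j) = cnj (A $$ (j,i))"
    and ord: "2 \<le> Polynomial.order (of_real x) (char_poly A)"
  obtains w :: "complex vec" where "w \<in> carrier_vec n" "w \<noteq> 0\<^sub>v n" "A *\<^sub>v w = of_real x \<cdot>\<^sub>v w" "w $ 0 = 0"
proof -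
  let ?x = "complex_of_real x"
  have mon: "monic (char_poly A)" using degree_monic_char_poly[OF A] by simp
  then have "char_poly A \<noteq> 0" by auto
  then have "[:- ?x, 1:] ^ 2 dvd char_poly A" using ord by (simp add: order_divides)
  then obtain q where q: "char_poly A = [:- ?x, 1:] ^ 2 * q" by (elim dvdE)
  have "lead_coeff q = 1" using mon unfolding q lead_coeff_mult lead_coeff_power by simp
  moreover obtain as where "Polynomial.smult (lead_coeff q) (\<Prod>a\<leftarrow>as. [:- a, 1:]) = q"
    using fundamental_theorem_algebra_factorized[of q] by blast
  ultimately have as: "q = (\<Prod>a\<leftarrow>as. [:- a, 1:])" by simp
  \<comment> \<open>Listing the double root first puts it on the first two diagonal places of the
    Schur form.\<close>
  have cp: "char_poly A = (\<Prod>a\<leftarrow>(?x # ?x # as). [:- a, 1:])"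
    unfolding q as by (simp only: list.map prod_list.Cons power2_eq_square mult.assoc)
  obtain B P Q where "schur_decomposition A (?x # ?x # as) = (B, P, Q)"
    by (rule prod_cases3)
  from schur_decomposition[OF A cp this]
  have wit: "similar_mat_wit A B P Q" and ut: "upper_triangular B" and diag: "diag_mat B = ?x # ?x # as"
    by auto
  note W = similar_mat_witD2[OF A wit]
  note B = W(5) and P = W(6) and Q = W(7)
  have "length (diag_mat B) = n" using B by (simp add: diag_mat_def)
  then have n: "1 < n" using diag by simp
  have B00: "B $$ (0,0) = ?x" and B11: "B $$ (1,1) = ?x"
    using arg_cong[OF diag, of "\<lambda>l. l ! 0"] arg_cong[OF diag, of "\<lambda>l. l ! 1"] B n
    by (simp_all add: diag_mat_def)
  have below: "B $$ (i,j) = 0" if "j < i" "i < n" for i j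
    using ut that B by (auto simp: upper_triangular_def)
  define e0 e1 :: "complex vec" where "e0 = unit_vec n 0" and "e1 = unit_vec n 1"
  have e: "e0 \<in> carrier_vec n" "e1 \<in> carrier_vec n" by (simp_all add: e0_def e1_def)
  define b where "b = B $$ (0,1)"
  have Be0: "B *\<^sub>v e0 = ?x \<cdot>\<^sub>v e0"
    unfolding e0_def using B n B00 below by (subst mult_mat_unit_vec[OF B]) (auto intro!: eq_vecI)
  have Be1: "B *\<^sub>v e1 = ?x \<cdot>\<^sub>v e1 + b \<cdot>\<^sub>v e0"
    unfolding e0_def e1_def b_def using B n B11 below[of 1]
    by (subst mult_mat_unit_vec[OF B]) (auto intro!: eq_vecI simp: unit_vec_def)
  have AP: "A *\<^sub>v (P *\<^sub>v v) = P *\<^sub>v (B *\<^sub>v v)" if v: "v \<in> carrier_vec n" for v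
  proof -
    have "A * P = P * B * (Q * P)"
      unfolding W(3) using B P Q by (intro assoc_mult_mat[of "P * B" n n Q n P n]) simp_all
    then have "A * P = P * B" unfolding W(2) using B P by (simp add: right_mult_one_mat[of _ n n])
    then show ?thesis
      using assoc_mult_mat_vec[OF A P v] assoc_mult_mat_vec[OF P B v] by simp
  qed
  have QPv: "Q *\<^sub>v (P *\<^sub>v v) = v" if v: "v \<in> carrier_vec n" for v
    using assoc_mult_mat_vec[OF Q P v] W(2) v by simp
  define p q where "p = P *\<^sub>v e0" and "q = P *\<^sub>v e1"
  have pq: "p \<in> carrier_vec n" "q \<in> carrier_vec n" using P e by (simp_all add: p_def q_def)
  have Ap: "A *\<^sub>v p = ?x \<cdot>\<^sub>v p"
    unfolding p_def AP[OF e(1)] Be0 using P e by (simp add: mult_mat_vec)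
  have Aq: "A *\<^sub>v q = ?x \<cdot>\<^sub>v q + b \<cdot>\<^sub>v p"
    unfolding p_def q_def AP[OF e(2)] Be1 using P e
    by (simp add: mult_mat_vec mult_add_distrib_mat_vec[of _ n n])
  have "A *\<^sub>v (b \<cdot>\<^sub>v p) = ?x \<cdot>\<^sub>v (b \<cdot>\<^sub>v p)"
    using A pq Ap by (simp add: mult_mat_vec smult_smult_assoc mult.commute)
  \<comment> \<open>The off-diagonal entry \<open>b\<close> makes \<open>q\<close> a generalized
    eigenvector; self-adjointness removes the extra term, so \<open>q\<close> is an eigenvector like
    \<open>p\<close>.\<close>
  then have bp: "b \<cdot>\<^sub>v p = 0\<^sub>v n"
    using hermitian_generalized_eigenvector[OF A herm pq(2) _ Aq] pq by simp
  then have Aq': "A *\<^sub>v q = ?x \<cdot>\<^sub>v q" using Aq pq by simp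
  have Q0: "(Q *\<^sub>v 0\<^sub>v n) $ i = 0" if "i < n" for i
    using scalar_prod_right_zero[OF row_carrier_vec[OF that Q]] that Q by simp
  show thesis
  proof (cases "p $ 0 = 0")
    case True
    have "p \<noteq> 0\<^sub>v n"
    proof
      assume "p = 0\<^sub>v n"
      then have "e0 = Q *\<^sub>v 0\<^sub>v n" using QPv[OF e(1)] by (simp add: p_def)
      then have "e0 $ 0 = 0" using Q0[of 0] n by simp
      then show False using n by (simp add: e0_def)
    qed
    then show thesis by (rule that[OF pq(1) _ Ap True])
  next
    case False
    \<comment> \<open>The combination cancels the first coordinate. It is nonzero because
      \<open>Q\<close> carries it to a vector whose entry at index 1 is
      \<open>- p $ 0\<close>.\<close>
    define w where "w = q $ 0 \<cdot>\<^sub>v p + (- p $ 0) \<cdot>\<^sub>v q"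
    have w: "w \<in> carrier_vec n" using pq by (simp add: w_def)
    have "w = P *\<^sub>v (q $ 0 \<cdot>\<^sub>v e0 + (- p $ 0) \<cdot>\<^sub>v e1)"
      unfolding w_def p_def q_def using P e by (simp add: mult_mat_vec mult_add_distrib_mat_vec[of _ n n])
    then have "Q *\<^sub>v w = q $ 0 \<cdot>\<^sub>v e0 + (- p $ 0) \<cdot>\<^sub>v e1" using QPv e by simp
    then have "(Q *\<^sub>v w) $ 1 = - p $ 0" using n by (simp add: e0_def e1_def)
    moreover have "(Q *\<^sub>v 0\<^sub>v n) $ 1 = 0" using Q0[of 1] n by simp
    ultimately have "w \<noteq> 0\<^sub>v n" using False by auto
    moreover have "A *\<^sub>v w = ?x \<cdot>\<^sub>v w"
      unfolding w_def using A pq Ap Aq'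
      by (simp add: mult_mat_vec mult_add_distrib_mat_vec[of _ n n] smult_add_distrib_vec[of _ n]
          smult_smult_assoc mult.commute)
    moreover have "w $ 0 = 0" unfolding w_def using pq n by simp
    ultimately show thesis by (rule that[OF w])
  qed
qed

section \<open>The eigenvalue equation of a truncation\<close>

lemma mat_adjoint_index:
  fixes A :: "complex mat"
  assumes "i < dim_col A" "j < dim_row A"
  shows "mat_adjoint A $$ (i,j) = cnj (A $$ (j,i))"
  using assms by (simp add: mat_adjoint_def mat_of_rows_index)

text \<open>The determinant of the tridiagonal matrix with diagonal
  \<open>a 0, ..., a (n - 1)\<close> and off-diagonal entries 1; equivalently the solution of the
  scalar recursion with value 0 at index -1 and 1 at index 0.\<close>

fun continuant :: "(nat \<Rightarrow> real) \<Rightarrow> nat \<Rightarrow> real" where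
  "continuant a 0 = 1"
| "continuant a (Suc 0) = a 0"
| "continuant a (Suc (Suc n)) = a (Suc n) * continuant a (Suc n) - continuant a n"

lemma sum_even_odd:
  fixes g :: "nat \<Rightarrow> 'b::comm_monoid_add"
  shows "(\<Sum>k<2*N. g k) = (\<Sum>l<N. g (2*l) + g (2*l+1))"
  by (induction N) (simp_all add: add.assoc)

locale block_jacobi =
  fixes T :: "'a \<Rightarrow> 'a" and f :: "'a \<Rightarrow> complex mat" and \<omega> :: 'a and N :: nat
  assumes dim: "\<And>\<omega>. f \<omega> \<in> carrier_mat 2 2"
    and adj: "\<And>\<omega>. mat_adjoint (f \<omega>) = f \<omega>"
    and N: "0 < N"
begin

abbreviation H :: "complex mat" where "H \<equiv> trunc_op T f \<omega> N"

text \<open>Block \<open>j\<close>, counted from 0, belongs to site \<open>j + 1\<close>; hence the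
  \<open>Suc\<close>.\<close>

abbreviation V :: "nat \<Rightarrow> complex mat" where "V j \<equiv> f ((T ^^ Suc j) \<omega>)"

lemma f_hermitian: "i < 2 \<Longrightarrow> j < 2 \<Longrightarrow> f \<xi> $$ (i,j) = cnj (f \<xi> $$ (j,i))"
  using mat_adjoint_index[of i "f \<xi>" j] dim[of \<xi>] adj[of \<xi>] by auto

lemma f_diag_real: "i < 2 \<Longrightarrow> f \<xi> $$ (i,i) = of_real (Re (f \<xi> $$ (i,i)))"
  using f_hermitian[of i i \<xi>] by (simp add: complex_eq_iff)

lemma H_carrier: "H \<in> carrier_mat (2*N) (2*N)"
  by (simp add: trunc_op_def)

lemma H_hermitian: "i < 2*N \<Longrightarrow> j < 2*N \<Longrightarrow> H $$ (i,j) = cnj (H $$ (j,i))"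
  using f_hermitian[of "i mod 2" "j mod 2" "(T ^^ Suc (i div 2)) \<omega>"]
  by (auto simp: trunc_op_def)

lemma H_even:
  assumes "j < N" "l < N"
  shows "H $$ (2*j, 2*l) = (if l = j then V j $$ (0,0) else 0) + (if l = Suc j then 1 else 0)
      + (if 0 < j \<and> l = j - 1 then 1 else 0)"
    "H $$ (2*j, Suc (2*l)) = (if l = j then V j $$ (0,1) else 0)"
    "H $$ (Suc (2*j), 2*l) = (if l = j then V j $$ (1,0) else 0)"
    "H $$ (Suc (2*j), Suc (2*l)) = (if l = j then V j $$ (1,1) else 0)"
  using assms by (auto simp: trunc_op_def)

lemma H_mult_index:
  assumes v: "v \<in> carrier_vec (2*N)" and j: "j < N"
  shows "(H *\<^sub>v v) $ (2*j) = V j $$ (0,0) * v $ (2*j) + V j $$ (0,1) * v $ Suc (2*j)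
      + (if Suc j < N then v $ (2 * Suc j) else 0) + (if 0 < j then v $ (2 * (j - 1)) else 0)"
    "(H *\<^sub>v v) $ Suc (2*j) = V j $$ (1,0) * v $ (2*j) + V j $$ (1,1) * v $ Suc (2*j)"
proof -
  have mult: "(H *\<^sub>v v) $ i = (\<Sum>l<N. H $$ (i,2*l) * v $ (2*l) + H $$ (i,Suc (2*l)) * v $ Suc (2*l))"
    if "i < 2*N" for i
    using sum_even_odd[of "\<lambda>k. H $$ (i,k) * v $ k" N] that v H_carrier
    by (simp add: scalar_prod_def lessThan_atLeast0)
  \<comment> \<open>All conditions take the form \<open>l = c\<close> so that
    \<open>sum.delta\<close> applies; the guard \<open>0 < j\<close> moves inside because
    \<open>j - 1\<close> is 0 at \<open>j = 0\<close>.\<close>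
  have "(H *\<^sub>v v) $ (2*j) = (\<Sum>l<N. (if l = j then V j $$ (0,0) * v $ (2*l) else 0)
      + (if l = j then V j $$ (0,1) * v $ Suc (2*l) else 0)
      + (if l = Suc j then v $ (2*l) else 0) + (if l = j - 1 then if 0 < j then v $ (2*l) else 0 else 0))"
  proof (subst mult)
    show "2 * j < 2 * N" using j by simp
    show "(\<Sum>l<N. H $$ (2*j,2*l) * v $ (2*l) + H $$ (2*j,Suc (2*l)) * v $ Suc (2*l)) =
      (\<Sum>l<N. (if l = j then V j $$ (0,0) * v $ (2*l) else 0)
        + (if l = j then V j $$ (0,1) * v $ Suc (2*l) else 0)
        + (if l = Suc j then v $ (2*l) else 0) + (if l = j - 1 then if 0 < j then v $ (2*l) else 0 else 0))"
    proof (rule sum.cong[OF refl])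
      fix l assume "l \<in> {..<N}"
      then show "H $$ (2*j,2*l) * v $ (2*l) + H $$ (2*j,Suc (2*l)) * v $ Suc (2*l) =
        (if l = j then V j $$ (0,0) * v $ (2*l) else 0)
        + (if l = j then V j $$ (0,1) * v $ Suc (2*l) else 0)
        + (if l = Suc j then v $ (2*l) else 0) + (if l = j - 1 then if 0 < j then v $ (2*l) else 0 else 0)"
        using j H_even[of j l] by (cases "l = j"; cases "l = Suc j"; cases "0 < j \<and> l = j - 1") auto
    qed
  qed
  also have "\<dots> = V j $$ (0,0) * v $ (2*j) + V j $$ (0,1) * v $ Suc (2*j)
      + (if Suc j < N then v $ (2 * Suc j) else 0) + (if 0 < j then v $ (2 * (j - 1)) else 0)"
    unfolding sum.distrib sum.delta[OF finite_lessThan] using j by auto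
  finally show "(H *\<^sub>v v) $ (2*j) = V j $$ (0,0) * v $ (2*j) + V j $$ (0,1) * v $ Suc (2*j)
      + (if Suc j < N then v $ (2 * Suc j) else 0) + (if 0 < j then v $ (2 * (j - 1)) else 0)" .
  have "(H *\<^sub>v v) $ Suc (2*j) = (\<Sum>l<N. (if l = j then V j $$ (1,0) * v $ (2*l) else 0)
      + (if l = j then V j $$ (1,1) * v $ Suc (2*l) else 0))"
  proof (subst mult)
    show "Suc (2 * j) < 2 * N" using j by simp
    show "(\<Sum>l<N. H $$ (Suc (2*j),2*l) * v $ (2*l) + H $$ (Suc (2*j),Suc (2*l)) * v $ Suc (2*l)) =
      (\<Sum>l<N. (if l = j then V j $$ (1,0) * v $ (2*l) else 0)
        + (if l = j then V j $$ (1,1) * v $ Suc (2*l) else 0))"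
    proof (rule sum.cong[OF refl])
      fix l assume "l \<in> {..<N}"
      then show "H $$ (Suc (2*j),2*l) * v $ (2*l) + H $$ (Suc (2*j),Suc (2*l)) * v $ Suc (2*l) =
        (if l = j then V j $$ (1,0) * v $ (2*l) else 0) + (if l = j then V j $$ (1,1) * v $ Suc (2*l) else 0)"
        using j H_even[of j l] by (cases "l = j") auto
    qed
  qed
  also have "\<dots> = V j $$ (1,0) * v $ (2*j) + V j $$ (1,1) * v $ Suc (2*j)"
    unfolding sum.distrib sum.delta[OF finite_lessThan] using j by simp
  finally show "(H *\<^sub>v v) $ Suc (2*j) = V j $$ (1,0) * v $ (2*j) + V j $$ (1,1) * v $ Suc (2*j)" .
qed

context
  fixes x :: real
  assumes x: "\<And>\<xi>. x \<noteq> Re (f \<xi> $$ (1,1))"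
begin

abbreviation a :: "nat \<Rightarrow> real" where "a j \<equiv> AE_entry f x ((T ^^ Suc j) \<omega>)"

text \<open>What remains on the first component once the second is eliminated; by self-adjointness
  the product of the off-diagonal entries is the squared modulus in \<open>AE_entry\<close>.\<close>

lemma schur_complement:
  fixes z :: complex
  shows "(of_real x - V j $$ (0,0)) * z - V j $$ (0,1) * (V j $$ (1,0) * z / (of_real x - V j $$ (1,1)))
    = of_real (a j) * z"
proof -
  have "V j $$ (0,1) * V j $$ (1,0) = of_real ((cmod (V j $$ (0,1)))\<^sup>2)"
    using f_hermitian[of 1 0 "(T ^^ Suc j) \<omega>"] complex_norm_square[of "V j $$ (0,1)"] by simp
  moreover have "V j $$ (0,0) = of_real (Re (V j $$ (0,0)))" "V j $$ (1,1) = of_real (Re (V j $$ (1,1)))"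
    by (rule f_diag_real; simp)+
  ultimately show ?thesis
    unfolding AE_entry_def by (simp add: algebra_simps)
qed

lemma denominator_nz: "complex_of_real x - V j $$ (1,1) \<noteq> 0"
  using x[of "(T ^^ Suc j) \<omega>"] by (metis Re_complex_of_real eq_iff_diff_eq_0)

text \<open>Odd rows determine the second components, and even rows then become the recursion of the
  continuants. The last even row has no right neighbour, which forces the value at \<open>N\<close>
  to vanish.\<close>

lemma eigenvector_eq_continuant:
  assumes v: "v \<in> carrier_vec (2*N)" and Hv: "H *\<^sub>v v = of_real x \<cdot>\<^sub>v v"
  shows "j < N \<Longrightarrow> v $ (2*j) = v $ 0 * of_real (continuant a j)"
    "j < N \<Longrightarrow> v $ Suc (2*j) = V j $$ (1,0) * v $ (2*j) / (of_real x - V j $$ (1,1))"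
    "v $ 0 * of_real (continuant a N) = 0"
proof -
  have odd: "v $ Suc (2*j) = V j $$ (1,0) * v $ (2*j) / (of_real x - V j $$ (1,1))" if j: "j < N" for j
  proof -
    have "V j $$ (1,0) * v $ (2*j) + V j $$ (1,1) * v $ Suc (2*j) = of_real x * v $ Suc (2*j)"
      using H_mult_index(2)[OF v j] j v unfolding Hv by simp
    then show ?thesis using denominator_nz[of j] by (simp add: eq_divide_eq algebra_simps)
  qed
  \<comment> \<open>Extension by zero at block \<open>N\<close> makes the boundary row an instance
    of the general recursion.\<close>
  define w where "w j = (if j < N then v $ (2*j) else 0)" for j
  have step: "w (Suc j) = of_real (a j) * w j - (if 0 < j then w (j - 1) else 0)" if j: "j < N" for j
  proof -
    have "V j $$ (0,0) * v $ (2*j) + V j $$ (0,1) * v $ Suc (2*j)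
      + w (Suc j) + (if 0 < j then w (j - 1) else 0) = of_real x * v $ (2*j)"
      using H_mult_index(1)[OF v j] j v unfolding Hv by (simp add: w_def)
    then have "w (Suc j) = (of_real x - V j $$ (0,0)) * v $ (2*j) - V j $$ (0,1) * v $ Suc (2*j)
      - (if 0 < j then w (j - 1) else 0)" by (simp add: algebra_simps)
    then show ?thesis unfolding odd[OF j] schur_complement using j by (simp add: w_def)
  qed
  have w: "j \<le> N \<Longrightarrow> w j = w 0 * of_real (continuant a j)" for j
  proof (induction j rule: less_induct)
    case (less j)
    consider "j = 0" | "j = Suc 0" | n where "j = Suc (Suc n)" by (metis not0_implies_Suc)
    then show ?case
    proof cases
      case 2
      then show ?thesis using step[of 0] less.prems by simp
    next
      case (3 n)
      have "w (Suc n) = w 0 * of_real (continuant a (Suc n))" "w n = w 0 * of_real (continuant a n)"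
        by (rule less.IH; use less.prems 3 in simp)+
      then show ?thesis using step[of "Suc n"] less.prems 3 by (simp add: algebra_simps)
    qed simp
  qed
  show "j < N \<Longrightarrow> v $ (2*j) = v $ 0 * of_real (continuant a j)" using w[of j] N by (simp add: w_def)
  show "v $ 0 * of_real (continuant a N) = 0" using w[of N] N by (simp add: w_def)
  show "j < N \<Longrightarrow> v $ Suc (2*j) = V j $$ (1,0) * v $ (2*j) / (of_real x - V j $$ (1,1))" by (rule odd)
qed

lemma eigenvector_first_entry:
  assumes v: "v \<in> carrier_vec (2*N)" and Hv: "H *\<^sub>v v = of_real x \<cdot>\<^sub>v v" and v0: "v $ 0 = 0"
  shows "v = 0\<^sub>v (2*N)"
proof (rule eq_vecI)
  fix i assume "i < dim_vec (0\<^sub>v (2*N) :: complex vec)"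
  then have i: "i div 2 < N" by simp
  have even: "v $ (2 * (i div 2)) = 0"
    using eigenvector_eq_continuant(1)[OF v Hv i] v0 by simp
  then have odd: "v $ Suc (2 * (i div 2)) = 0"
    using eigenvector_eq_continuant(2)[OF v Hv i] by simp
  have "i = 2 * (i div 2) \<or> i = Suc (2 * (i div 2))" by presburger
  then have "v $ i = 0" using even odd by metis
  then show "v $ i = 0\<^sub>v (2*N) $ i" using i by simp
qed (use v in simp)

lemma root_iff_continuant: "poly (char_poly H) (of_real x) = 0 \<longleftrightarrow> continuant a N = 0"
proof
  assume "poly (char_poly H) (of_real x) = 0"
  then obtain v where v: "v \<in> carrier_vec (2*N)" "v \<noteq> 0\<^sub>v (2*N)" "H *\<^sub>v v = of_real x \<cdot>\<^sub>v v"
    using H_carrier unfolding eigenvalue_root_char_poly[OF H_carrier, symmetric] eigenvalue_def eigenvector_def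
    by auto
  then have "v $ 0 \<noteq> 0" using eigenvector_first_entry by blast
  then show "continuant a N = 0" using eigenvector_eq_continuant(3)[OF v(1,3)] by simp
next
  assume zero: "continuant a N = 0"
  \<comment> \<open>The forced form of an eigenvector: continuants as first components, second
    components solving the odd rows. The vanishing of \<open>continuant a N\<close> is what the last
    even row asks for.\<close>
  define v where "v = vec (2*N) (\<lambda>i. let j = i div 2; z = complex_of_real (continuant a j) in
    if even i then z else V j $$ (1,0) * z / (of_real x - V j $$ (1,1)))"
  have v: "v \<in> carrier_vec (2*N)" by (simp add: v_def)
  have even: "v $ (2*j) = of_real (continuant a j)"
    and odd: "v $ Suc (2*j) = V j $$ (1,0) * of_real (continuant a j) / (of_real x - V j $$ (1,1))"
    if "j < N" for j
    using that by (simp_all add: v_def Let_def)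
  have nxt: "(if Suc j < N then v $ (2 * Suc j) else 0) = of_real (continuant a (Suc j))" if "j < N" for j
    using that zero even[of "Suc j"] by (cases "Suc j = N") auto
  have rec: "of_real (continuant a (Suc j)) = complex_of_real (a j) * of_real (continuant a j)
     - (if 0 < j then of_real (continuant a (j - 1)) else 0)" for j
    by (cases j) simp_all
  have "H *\<^sub>v v = of_real x \<cdot>\<^sub>v v"
  proof (rule eq_vecI)
    fix i assume "i < dim_vec (complex_of_real x \<cdot>\<^sub>v v)"
    then have i: "i < 2*N" using v by simp
    define j where "j = i div 2"
    have j: "j < N" using i by (simp add: j_def)
    have "i = 2*j \<or> i = Suc (2*j)" unfolding j_def by presburger
    then show "(H *\<^sub>v v) $ i = (of_real x \<cdot>\<^sub>v v) $ i"
    proof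
      assume ij: "i = 2*j"
      have "(H *\<^sub>v v) $ (2*j) = of_real x * of_real (continuant a j)"
        using schur_complement[of j "of_real (continuant a j)"] j even[of "j - 1"]
        unfolding H_mult_index(1)[OF v j] nxt[OF j] rec even[OF j] odd[OF j]
        by (auto simp: algebra_simps)
      then show ?thesis using ij i v even[OF j] by simp
    next
      assume ij: "i = Suc (2*j)"
      have "(H *\<^sub>v v) $ Suc (2*j) = of_real x * v $ Suc (2*j)"
        unfolding H_mult_index(2)[OF v j] even[OF j] odd[OF j]
        using denominator_nz[of j] by (simp add: divide_simps) (simp add: algebra_simps)
      then show ?thesis using ij i v by simp
    qed
  qed (use v H_carrier in simp)
  moreover have "v $ 0 \<noteq> 0" using even[of 0] N by simp
  then have "v \<noteq> 0\<^sub>v (2*N)" using N by auto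
  ultimately show "poly (char_poly H) (of_real x) = 0"
    using v H_carrier unfolding eigenvalue_root_char_poly[OF H_carrier, symmetric] eigenvalue_def eigenvector_def
    by auto
qed

text \<open>A multiple root would supply a nonzero eigenvector with vanishing first entry, which the
  recursion excludes.\<close>

lemma root_simple:
  assumes "poly (char_poly H) (of_real x) = 0"
  shows "Polynomial.order (of_real x) (char_poly H) = 1"
proof (rule ccontr)
  assume "Polynomial.order (of_real x) (char_poly H) \<noteq> 1"
  moreover have "char_poly H \<noteq> 0" using degree_monic_char_poly[OF H_carrier] by auto
  then have "Polynomial.order (of_real x) (char_poly H) \<noteq> 0" using assms order_root by blast
  ultimately have "2 \<le> Polynomial.order (of_real x) (char_poly H)" by simp
  from hermitian_double_root_eigenvector[OF H_carrier H_hermitian this]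
  obtain w where "w \<in> carrier_vec (2*N)" "w \<noteq> 0\<^sub>v (2*N)" "H *\<^sub>v w = of_real x \<cdot>\<^sub>v w" "w $ 0 = 0"
    by blast
  then show False using eigenvector_first_entry by blast
qed

end

end

section \<open>Rotation number and eigenvalue counting\<close>

text \<open>Both sides are the sum of the first \<open>n + m\<close> terms minus the sums of the
  first \<open>n\<close> and of the first \<open>m\<close> terms.\<close>

lemma sum_shift_difference:
  fixes c :: "nat \<Rightarrow> real"
  shows "(\<Sum>i<n. c (i + m) - c i) = (\<Sum>i<m. c (n + i) - c i)"
proof (induction n)
  case (Suc n)
  have "(\<Sum>i<m. c (Suc n + i) - c i) = (\<Sum>i<m. c (n + Suc i) - c (n + i)) + (\<Sum>i<m. c (n + i) - c i)"
    by (simp flip: sum.distrib)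
  also have "(\<Sum>i<m. c (n + Suc i) - c (n + i)) = c (n + m) - c n"
    using sum_lessThan_telescope[of "\<lambda>i. c (n + i)" m] by simp
  finally show ?case using Suc by simp
qed simp

text \<open>Summing the cocycle identity over \<open>n\<close> starting points in two ways shows that \<open>m\<close> times the
  displacement of \<open>n\<close> steps is nearly the Birkhoff sum of the displacement of \<open>m\<close> steps.\<close>
lemma lift_iter_birkhoff_sum:
  "\<bar>real m * lift_iter T a n \<omega> 0 - (\<Sum>i<n. lift_iter T a m ((T ^^ i) \<omega>) 0)\<bar> \<le> real n + 2 * (real m)\<^sup>2"
proof -
  define c where "c i = lift_iter T a i \<omega> 0" for i
  define h where "h \<xi> = lift_iter T a m \<xi> 0" for \<xi>
  have "\<bar>(\<Sum>i<n. c (i + m) - c i) - (\<Sum>i<n. h ((T ^^ i) \<omega>))\<bar> \<le> (\<Sum>i<n. 1)"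
    unfolding sum_subtractf[symmetric]
  proof (rule order_trans[OF sum_abs sum_mono])
    fix i
    show "\<bar>c (i + m) - c i - h ((T ^^ i) \<omega>)\<bar> \<le> 1"
      unfolding c_def h_def lift_iter_add by (rule lift_iter_base_point)
  qed
  moreover have "\<bar>(\<Sum>i<m. c (n + i) - c i) - (\<Sum>i<m. c n)\<bar> \<le> (\<Sum>i<m. 2 * real m)"
    unfolding sum_subtractf[symmetric]
  proof (rule order_trans[OF sum_abs sum_mono])
    fix i assume "i \<in> {..<m}"
    moreover have "\<bar>c (n + i) - c n\<bar> \<le> real i"
      unfolding c_def lift_iter_add by (rule lift_iter_displacement)
    moreover have "\<bar>c i\<bar> \<le> real i" unfolding c_def using lift_iter_displacement[of T a i \<omega> 0] by simp
    ultimately show "\<bar>c (n + i) - c i - c n\<bar> \<le> 2 * real m" by simp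
  qed
  ultimately show ?thesis
    unfolding sum_shift_difference c_def[symmetric] h_def[symmetric] by (simp add: power2_eq_square)
qed

text \<open>The space average \<open>I m\<close> of the displacement per step over \<open>m\<close>
  steps approximates the angle per step within \<open>2 / real m\<close> on every orbit. Hence the
  \<open>I m\<close> form a Cauchy sequence, and the angle per step converges to its limit.\<close>

theorem rot_num_limit:
  fixes T :: "'a::metric_space \<Rightarrow> 'a" and a :: "'a \<Rightarrow> real"
  assumes cpt: "compact (UNIV :: 'a set)"
    and T: "bij T" "continuous_on UNIV T" "continuous_on UNIV (inv_into UNIV T)"
    and ue: "uniquely_ergodic T \<nu>"
    and a: "continuous_on UNIV a"
  shows "(\<lambda>n. (lift_iter T a n \<omega> t - t) / real n) \<longlonglongrightarrow> rot_num T a"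
proof -
  define I where "I m = (\<integral>\<omega>. lift_iter T a m \<omega> 0 \<partial>\<nu>) / real m" for m
  have near: "eventually (\<lambda>n. \<bar>lift_iter T a n \<omega> 0 / real n - I m\<bar> \<le> 2 / real m) sequentially"
    if m: "0 < m" for m \<omega>
  proof -
    let ?h = "\<lambda>\<omega>. lift_iter T a m \<omega> 0"
    have "birkhoff_avg T ?h \<omega> \<longlonglongrightarrow> (\<integral>\<omega>. ?h \<omega> \<partial>\<nu>)"
      by (rule uniquely_ergodic_birkhoff[OF cpt T ue continuous_on_lift_iter[OF T(2) a]])
    then have "(\<lambda>n. birkhoff_avg T ?h \<omega> n / real m) \<longlonglongrightarrow> I m"
      unfolding I_def by (intro tendsto_divide) (use m in auto)
    \<comment> \<open>Two errors of \<open>1 / (2 * real m)\<close>, from the Birkhoff average and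
      from the term \<open>2 * real m / real n\<close>, complete the \<open>1 / real m\<close> of
      \<open>lift_iter_birkhoff_sum\<close> to \<open>2 / real m\<close>.\<close>
    then have "eventually (\<lambda>n. dist (birkhoff_avg T ?h \<omega> n / real m) (I m) < 1 / (2 * real m)) sequentially"
      using m by (intro tendstoD) auto
    moreover have "(\<lambda>n. (2 * real m) / real n) \<longlonglongrightarrow> 0" by (rule lim_const_over_n)
    then have "eventually (\<lambda>n. dist ((2 * real m) / real n) 0 < 1 / (2 * real m)) sequentially"
      using m by (intro tendstoD) auto
    ultimately show ?thesis using eventually_gt_at_top[of 0]
    proof eventually_elim
      case (elim n)
      have "lift_iter T a n \<omega> 0 / real n - birkhoff_avg T ?h \<omega> n / real m
          = (real m * lift_iter T a n \<omega> 0 - (\<Sum>i<n. ?h ((T ^^ i) \<omega>))) / (real m * real n)"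
        using m elim(3) by (simp add: birkhoff_avg_def diff_divide_distrib mult.commute)
      then have "\<bar>lift_iter T a n \<omega> 0 / real n - birkhoff_avg T ?h \<omega> n / real m\<bar>
          = \<bar>real m * lift_iter T a n \<omega> 0 - (\<Sum>i<n. ?h ((T ^^ i) \<omega>))\<bar> / (real m * real n)"
        by (simp only: abs_divide abs_mult abs_of_nat)
      also have "\<dots> \<le> (real n + 2 * (real m)\<^sup>2) / (real m * real n)"
        using m by (intro divide_right_mono lift_iter_birkhoff_sum) auto
      also have "\<dots> = 1 / real m + 2 * real m / real n"
        using m elim(3) by (simp add: field_simps power2_eq_square)
      finally have 1: "\<bar>lift_iter T a n \<omega> 0 / real n - birkhoff_avg T ?h \<omega> n / real m\<bar>
          \<le> 1 / real m + 2 * real m / real n" .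
      have "1 / real m = 1 / (2 * real m) + 1 / (2 * real m)" "2 / real m = 1 / real m + 1 / real m"
        using m by (simp_all add: field_simps)
      with 1 elim(1,2) show ?case unfolding dist_real_def diff_0_right by linarith
    qed
  qed
  have II: "\<bar>I m - I k\<bar> \<le> 2 / real m + 2 / real k" if mk: "0 < m" "0 < k" for m k
  proof -
    have "eventually (\<lambda>n. \<bar>I m - I k\<bar> \<le> 2 / real m + 2 / real k) sequentially"
      using near[OF mk(1), of \<omega>] near[OF mk(2), of \<omega>] by eventually_elim linarith
    then show ?thesis by (simp add: eventually_const)
  qed
  have "Cauchy I"
  proof (rule CauchyI)
    fix e :: real assume "0 < e"
    obtain M :: nat where M: "4 / e < real M" using reals_Archimedean2 by blast
    then have "0 < M" using \<open>0 < e\<close> by (cases M) (auto simp: divide_less_0_iff not_less)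
    have "norm (I m - I k) < e" if "M \<le> m" "M \<le> k" for m k
    proof -
      have "2 / real m \<le> 2 / real M" "2 / real k \<le> 2 / real M"
        using that \<open>0 < M\<close> by (auto intro!: divide_left_mono)
      moreover have "2 / real M + 2 / real M < e" using M \<open>0 < e\<close> \<open>0 < M\<close> by (simp add: field_simps)
      ultimately show ?thesis using II[of m k] that \<open>0 < M\<close> by simp
    qed
    then show "\<exists>M. \<forall>m\<ge>M. \<forall>n\<ge>M. norm (I m - I n) < e" by blast
  qed
  then obtain r where r: "I \<longlonglongrightarrow> r" using Cauchy_convergent by (auto simp: convergent_def)
  have lim0: "(\<lambda>n. lift_iter T a n \<omega> 0 / real n) \<longlonglongrightarrow> r" for \<omega>
  proof (rule tendstoI)
    fix e :: real assume "0 < e"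
    have "eventually (\<lambda>m. dist (I m) r < e/2) sequentially" using r \<open>0 < e\<close> by (intro tendstoD) auto
    moreover have "eventually (\<lambda>m. dist (2 / real m) 0 < e/2) sequentially"
      using lim_const_over_n[of "2::real"] \<open>0 < e\<close> by (intro tendstoD) auto
    ultimately have "eventually (\<lambda>m. 0 < m \<and> dist (I m) r < e/2 \<and> 2 / real m < e/2) sequentially"
      using eventually_gt_at_top[of 0] by eventually_elim simp
    then obtain m where m: "0 < m" "dist (I m) r < e/2" "2 / real m < e/2"
      using eventually_happens'[OF sequentially_bot] by blast
    show "eventually (\<lambda>n. dist (lift_iter T a n \<omega> 0 / real n) r < e) sequentially"
      using near[OF m(1), of \<omega>]
    proof eventually_elim
      case (elim n)
      then show ?case using m(2,3) unfolding dist_real_def by linarith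
    qed
  qed
  have lim: "(\<lambda>n. (lift_iter T a n \<omega> t - t) / real n) \<longlonglongrightarrow> r" for \<omega> t
  proof -
    have "(\<lambda>n. (lift_iter T a n \<omega> t - t - lift_iter T a n \<omega> 0) / real n) \<longlonglongrightarrow> 0"
    proof (rule Lim_null_comparison)
      show "eventually (\<lambda>n. norm ((lift_iter T a n \<omega> t - t - lift_iter T a n \<omega> 0) / real n) \<le> 1 / real n) sequentially"
        using lift_iter_base_point[of T a _ \<omega> t] by (intro always_eventually allI) (simp add: abs_divide divide_right_mono)
      show "(\<lambda>n. 1 / real n) \<longlonglongrightarrow> 0" by (rule lim_const_over_n)
    qed
    from tendsto_add[OF this lim0[of \<omega>]] show ?thesis by (simp flip: add_divide_distrib)
  qed
  have "rot_num T a = r"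
    unfolding rot_num_def using lim LIMSEQ_unique by (intro the_equality) blast+
  then show ?thesis using lim by simp
qed

text \<open>Pairs of successive continuants are the orbit of \<open>(1,0)\<close>, at angle 0, under
  the cocycle; the case distinction supplies the value 0 at index -1.\<close>

lemma continuant_polar:
  "\<exists>R>0. continuant (\<lambda>j. a ((T ^^ j) \<omega>)) n = R * cos (2*pi*lift_iter T a n \<omega> 0) \<and>
    (case n of 0 \<Rightarrow> 0 | Suc k \<Rightarrow> continuant (\<lambda>j. a ((T ^^ j) \<omega>)) k) = R * sin (2*pi*lift_iter T a n \<omega> 0)"
proof (induction n)
  case 0
  show ?case by (intro exI[of _ 1]) simp
next
  case (Suc n)
  define u where "u = continuant (\<lambda>j. a ((T ^^ j) \<omega>))"
  define t where "t = lift_iter T a n \<omega> 0"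
  define b where "b = a ((T ^^ n) \<omega>)"
  obtain R where R: "0 < R" "u n = R * cos (2*pi*t)"
    "(case n of 0 \<Rightarrow> 0 | Suc k \<Rightarrow> u k) = R * sin (2*pi*t)"
    using Suc unfolding u_def t_def by blast
  have "u (Suc n) = b * u n - (case n of 0 \<Rightarrow> 0 | Suc k \<Rightarrow> u k)"
    unfolding u_def b_def by (cases n) simp_all
  also have "\<dots> = R * (b * cos (2*pi*t) - sin (2*pi*t))" unfolding R(2,3) by (simp add: algebra_simps)
  also have "\<dots> = R * schr_norm b t * cos (2*pi * schr_lift b t)"
    unfolding schr_lift_cos[symmetric] by (simp add: mult_ac)
  finally have "u (Suc n) = R * schr_norm b t * cos (2*pi * schr_lift b t)" .
  moreover have "u n = R * schr_norm b t * sin (2*pi * schr_lift b t)"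
    unfolding R(2) schr_lift_sin[of b t, symmetric] by (simp add: mult_ac)
  moreover have "0 < R * schr_norm b t" using R(1) schr_norm_pos by simp
  ultimately show ?case unfolding u_def t_def b_def by auto
qed

lemma continuant_eq_0_iff:
  "continuant (\<lambda>j. a ((T ^^ j) \<omega>)) n = 0 \<longleftrightarrow> cos (2*pi*lift_iter T a n \<omega> 0) = 0"
  using continuant_polar[of a T \<omega> n] by auto

text \<open>The first step starts at angle 0, where the dependence on the parameter is strict; later
  steps are strictly increasing in the angle and weakly decreasing in the parameter, so strictness
  persists.\<close>

lemma lift_iter_strict_antimono:
  assumes lt: "\<And>\<xi>. a \<xi> < a' \<xi>" and "0 < n"
  shows "lift_iter T a' n \<omega> 0 < lift_iter T a n \<omega> 0"
  using \<open>0 < n\<close>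
proof (induction n rule: nat_induct_non_zero)
  case 1
  show ?case using schr_lift_strict_antimono_parameter[OF _ _ lt] by simp
next
  case (Suc n)
  show ?case
    using schr_lift_antimono_parameter[OF less_imp_le[OF lt]] schr_lift_strict_mono[OF Suc(2)]
    by (auto intro: le_less_trans)
qed

lemma lift_iter_cone_pos:
  assumes "\<And>\<xi>. 2 \<le> a \<xi>"
  shows "0 \<le> lift_iter T a n \<omega> 0 \<and> lift_iter T a n \<omega> 0 \<le> 1/8"
  by (induction n) (use assms schr_lift_cone_pos in auto)

lemma lift_iter_cone_neg:
  assumes "\<And>\<xi>. a \<xi> \<le> -2"
  shows "real n / 2 - 1/8 \<le> lift_iter T a n \<omega> 0 \<and> lift_iter T a n \<omega> 0 \<le> real n / 2"
proof (induction n)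
  case (Suc n)
  then show ?case
    using schr_lift_cone_neg[OF assms, of n "lift_iter T a n \<omega> 0"] by simp
qed simp

section \<open>Counting crossings of a monotone angle\<close>

lemma cos_zero_set:
  "{v\<in>{y2..y1}. cos (2*pi * v) = 0} = (\<lambda>k::int. of_int k / 2 + 1/4) ` {\<lceil>2*y2 - 1/2\<rceil>..\<lfloor>2*y1 - 1/2\<rfloor>}"
proof (intro Set.set_eqI iffI)
  fix v :: real assume v: "v \<in> {v\<in>{y2..y1}. cos (2*pi * v) = 0}"
  then obtain k :: int where "2*pi * v = of_int k * pi + pi/2" by (auto simp: cos_zero_iff_int2)
  then have "pi * (2 * v - of_int k - 1/2) = 0" by (simp add: algebra_simps)
  then have k: "v = of_int k / 2 + 1/4" by simp
  have "\<lceil>2*y2 - 1/2\<rceil> \<le> k" "k \<le> \<lfloor>2*y1 - 1/2\<rfloor>"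
    using v k by (auto simp: ceiling_le_iff le_floor_iff)
  then show "v \<in> (\<lambda>k::int. of_int k / 2 + 1/4) ` {\<lceil>2*y2 - 1/2\<rceil>..\<lfloor>2*y1 - 1/2\<rfloor>}"
    using k by (intro image_eqI[of _ _ k]) auto
next
  fix v :: real assume "v \<in> (\<lambda>k::int. of_int k / 2 + 1/4) ` {\<lceil>2*y2 - 1/2\<rceil>..\<lfloor>2*y1 - 1/2\<rfloor>}"
  then obtain k :: int where k: "v = of_int k / 2 + 1/4" "\<lceil>2*y2 - 1/2\<rceil> \<le> k" "k \<le> \<lfloor>2*y1 - 1/2\<rfloor>" by auto
  then have "2*pi * v = of_int k * pi + pi/2" by (simp add: algebra_simps)
  then have "cos (2*pi * v) = 0" unfolding cos_zero_iff_int2 by blast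
  then show "v \<in> {v\<in>{y2..y1}. cos (2*pi * v) = 0}"
    using k by (simp add: ceiling_le_iff le_floor_iff)
qed

text \<open>By the intermediate value theorem \<open>\<theta>\<close> maps \<open>Z\<close>
  bijectively onto the points of \<open>1/4 + \<int>/2\<close> between its end values; their spacing
  is 1/2, so their number is twice the length up to 1.\<close>

lemma card_cos_zeros:
  fixes \<theta> :: "real \<Rightarrow> real"
  assumes le: "x1 \<le> x2" and cont: "continuous_on {x1..x2} \<theta>"
    and anti: "\<And>x y. x1 \<le> x \<Longrightarrow> x < y \<Longrightarrow> y \<le> x2 \<Longrightarrow> \<theta> y < \<theta> x"
  defines "Z \<equiv> {x\<in>{x1..x2}. cos (2*pi*\<theta> x) = 0}"
  shows "finite Z" "\<bar>real (card Z) - 2 * (\<theta> x1 - \<theta> x2)\<bar> \<le> 1"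
proof -
  have inj: "inj_on \<theta> {x1..x2}"
    by (rule linorder_inj_onI) (use anti in \<open>force+\<close>)
  have wanti: "\<theta> y \<le> \<theta> x" if "x1 \<le> x" "x \<le> y" "y \<le> x2" for x y
    using anti[of x y] that by (cases "x = y") auto
  have im: "\<theta> ` Z = {v\<in>{\<theta> x2..\<theta> x1}. cos (2*pi * v) = 0}"
  proof (intro Set.set_eqI iffI)
    fix v assume "v \<in> \<theta> ` Z"
    then show "v \<in> {v\<in>{\<theta> x2..\<theta> x1}. cos (2*pi * v) = 0}" using wanti le by (auto simp: Z_def)
  next
    fix v assume v: "v \<in> {v\<in>{\<theta> x2..\<theta> x1}. cos (2*pi * v) = 0}"
    then obtain x where "x1 \<le> x" "x \<le> x2" "\<theta> x = v"
      using IVT2'[of \<theta> x2 v x1] le cont by auto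
    then show "v \<in> \<theta> ` Z" using v by (auto simp: Z_def)
  qed
  have injZ: "inj_on \<theta> Z" by (rule inj_on_subset[OF inj]) (auto simp: Z_def)
  have "finite (\<theta> ` Z)" unfolding im cos_zero_set by simp
  then show "finite Z" using injZ by (rule finite_imageD)
  have "card Z = card (\<theta> ` Z)" by (rule card_image[OF injZ, symmetric])
  also have "\<dots> = card {\<lceil>2*\<theta> x2 - 1/2\<rceil>..\<lfloor>2*\<theta> x1 - 1/2\<rfloor>}"
    unfolding im cos_zero_set by (rule card_image) (simp add: inj_on_def)
  finally have "card Z = nat (\<lfloor>2*\<theta> x1 - 1/2\<rfloor> - \<lceil>2*\<theta> x2 - 1/2\<rceil> + 1)" by simp
  moreover have "\<theta> x2 \<le> \<theta> x1" using wanti le by simp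
  \<comment> \<open>Conversion to \<open>nat\<close> thus loses nothing, even when the set of
    integers is empty.\<close>
  then have "0 \<le> \<lfloor>2*\<theta> x1 - 1/2\<rfloor> - \<lceil>2*\<theta> x2 - 1/2\<rceil> + 1" by linarith
  ultimately have "real (card Z) = of_int \<lfloor>2*\<theta> x1 - 1/2\<rfloor> - of_int \<lceil>2*\<theta> x2 - 1/2\<rceil> + 1" by simp
  then show "\<bar>real (card Z) - 2 * (\<theta> x1 - \<theta> x2)\<bar> \<le> 1"
    using of_int_floor_le[of "2*\<theta> x1 - 1/2"] real_of_int_floor_add_one_gt[of "2*\<theta> x1 - 1/2"]
      le_of_int_ceiling[of "2*\<theta> x2 - 1/2"]
      conjunct1[OF ceiling_correct[of "2*\<theta> x2 - 1/2"]]
    unfolding right_diff_distrib by linarith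
qed

section \<open>The angle as a function of the energy\<close>

locale block_jacobi_family =
  fixes T :: "'a::metric_space \<Rightarrow> 'a" and f :: "'a \<Rightarrow> complex mat"
  assumes cpt: "compact (UNIV :: 'a set)"
    and fdim: "\<And>\<omega>. f \<omega> \<in> carrier_mat 2 2"
    and fcont: "\<And>i j. i < 2 \<Longrightarrow> j < 2 \<Longrightarrow> continuous_on UNIV (\<lambda>\<omega>. f \<omega> $$ (i,j))"
    and fsa: "\<And>\<omega>. mat_adjoint (f \<omega>) = f \<omega>"
begin

abbreviation f22 :: "'a \<Rightarrow> real" where "f22 \<xi> \<equiv> Re (f \<xi> $$ (1,1))"

text \<open>The orbit starts at \<open>T \<omega>\<close> because the first block of the truncation
  sits at site 1.\<close>

definition \<theta> :: "nat \<Rightarrow> 'a \<Rightarrow> real \<Rightarrow> real" where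
  "\<theta> N \<omega> x = lift_iter T (AE_entry f x) N (T \<omega>) 0"

lemma entry_bounded:
  assumes "i < 2" "j < 2"
  obtains B where "0 < B" "\<And>\<xi>. cmod (f \<xi> $$ (i,j)) \<le> B"
  using compact_imp_bounded[OF compact_continuous_image[OF fcont[OF assms] cpt]] by (auto simp: bounded_pos)

lemma bdd_f22: "bdd_above (range f22)" "bdd_below (range f22)"
proof -
  obtain B where B: "\<And>\<xi>. cmod (f \<xi> $$ (1,1)) \<le> B" using entry_bounded[of 1 1] by auto
  have "\<bar>f22 \<xi>\<bar> \<le> B" for \<xi> using abs_Re_le_cmod[of "f \<xi> $$ (1,1)"] B[of \<xi>] by simp
  then show "bdd_above (range f22)" "bdd_below (range f22)"
    by (auto simp: abs_le_iff intro!: bdd_aboveI[of _ B] bdd_belowI[of _ "-B"]) (smt (verit))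
qed

lemma continuous_on_AE_entry:
  assumes "\<And>\<xi>. E \<noteq> f22 \<xi>"
  shows "continuous_on UNIV (AE_entry f E)"
  unfolding AE_entry_def using assms by (intro continuous_intros fcont) auto

lemma continuous_on_\<theta>:
  assumes "\<And>x \<xi>. x \<in> S \<Longrightarrow> x \<noteq> f22 \<xi>"
  shows "continuous_on S (\<theta> N \<omega>)"
proof -
  have "continuous_on S (\<lambda>x. AE_entry f x \<xi>)" for \<xi>
    unfolding AE_entry_def using assms by (intro continuous_intros) auto
  then have "continuous_on S (\<lambda>x. lift_iter T (AE_entry f x) N \<xi> 0)" for \<xi>
    by (induction N) (auto intro!: continuous_intros)
  then show ?thesis unfolding \<theta>_def by simp
qed

text \<open>On either side of its pole at \<open>f22 \<xi>\<close> the subtracted fraction decreases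
  in the energy; the product condition treats both sides at once.\<close>

lemma AE_entry_strict_mono:
  assumes "x < y" and same_side: "\<And>\<xi>. 0 < (x - f22 \<xi>) * (y - f22 \<xi>)"
  shows "AE_entry f x \<xi> < AE_entry f y \<xi>"
proof -
  have "(cmod (f \<xi> $$ (0,1)))\<^sup>2 / (y - f22 \<xi>) \<le> (cmod (f \<xi> $$ (0,1)))\<^sup>2 / (x - f22 \<xi>)"
    using assms(1) same_side[of \<xi>] by (intro divide_left_mono) (simp_all add: mult.commute)
  then show ?thesis using assms(1) unfolding AE_entry_def by simp
qed

lemma \<theta>_strict_antimono:
  assumes "x < y" "\<And>\<xi>. 0 < (x - f22 \<xi>) * (y - f22 \<xi>)" "0 < N"
  shows "\<theta> N \<omega> y < \<theta> N \<omega> x"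
  unfolding \<theta>_def using assms AE_entry_strict_mono by (intro lift_iter_strict_antimono) auto

lemma AE_entry_large:
  assumes "\<And>\<xi>. f22 \<xi> \<le> s"
  obtains X where "s < X" "\<And>x \<xi>. X \<le> x \<Longrightarrow> 2 \<le> AE_entry f x \<xi>"
proof -
  obtain B where B: "0 < B" "\<And>\<xi>. cmod (f \<xi> $$ (0,0)) \<le> B" using entry_bounded[of 0 0] by auto
  obtain C where C: "0 < C" "\<And>\<xi>. cmod (f \<xi> $$ (0,1)) \<le> C" using entry_bounded[of 0 1] by auto
  show thesis
  \<comment> \<open>The bound \<open>s + 1\<close> keeps the denominator at least 1 and thus the
    fraction at most \<open>C\<^sup>2\<close>; the other bound then leaves 2.\<close>
  proof (rule that[of "max (s + 1) (2 + B + C\<^sup>2)"])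
    fix x \<xi> assume x: "max (s + 1) (2 + B + C\<^sup>2) \<le> x"
    have "(cmod (f \<xi> $$ (0,1)))\<^sup>2 / (x - f22 \<xi>) \<le> C\<^sup>2 / 1"
      using C(1) C(2)[of \<xi>] x assms[of \<xi>] by (intro frac_le power_mono) auto
    moreover have "Re (f \<xi> $$ (0,0)) \<le> B"
      using B(2)[of \<xi>] complex_Re_le_cmod[of "f \<xi> $$ (0,0)"] by simp
    ultimately show "2 \<le> AE_entry f x \<xi>" using x unfolding AE_entry_def by simp
  qed simp
qed

lemma AE_entry_small:
  assumes "\<And>\<xi>. s \<le> f22 \<xi>"
  obtains X where "X < s" "\<And>x \<xi>. x \<le> X \<Longrightarrow> AE_entry f x \<xi> \<le> -2"
proof -
  obtain B where B: "0 < B" "\<And>\<xi>. cmod (f \<xi> $$ (0,0)) \<le> B" using entry_bounded[of 0 0] by auto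
  obtain C where C: "0 < C" "\<And>\<xi>. cmod (f \<xi> $$ (0,1)) \<le> C" using entry_bounded[of 0 1] by auto
  show thesis
  proof (rule that[of "min (s - 1) (- 2 - B - C\<^sup>2)"])
    fix x \<xi> assume x: "x \<le> min (s - 1) (- 2 - B - C\<^sup>2)"
    have "(cmod (f \<xi> $$ (0,1)))\<^sup>2 / (f22 \<xi> - x) \<le> C\<^sup>2 / 1"
      using C(1) C(2)[of \<xi>] x assms[of \<xi>] by (intro frac_le power_mono) auto
    moreover have "(cmod (f \<xi> $$ (0,1)))\<^sup>2 / (x - f22 \<xi>) = - ((cmod (f \<xi> $$ (0,1)))\<^sup>2 / (f22 \<xi> - x))"
      by (metis minus_diff_eq minus_divide_right)
    moreover have "- B \<le> Re (f \<xi> $$ (0,0))"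
      using B(2)[of \<xi>] abs_Re_le_cmod[of "f \<xi> $$ (0,0)"] by simp
    ultimately show "AE_entry f x \<xi> \<le> -2" using x unfolding AE_entry_def by simp
  qed simp
qed

section \<open>Counting eigenvalues by the angle\<close>

lemma char_poly_real_root:
  assumes "0 < N" "\<And>\<xi>. x \<noteq> f22 \<xi>"
  shows "poly (char_poly (trunc_op T f \<omega> N)) (of_real x) = 0 \<longleftrightarrow> cos (2*pi*\<theta> N \<omega> x) = 0"
    and "poly (char_poly (trunc_op T f \<omega> N)) (of_real x) = 0 \<Longrightarrow>
      Polynomial.order (of_real x) (char_poly (trunc_op T f \<omega> N)) = 1"
proof -
  interpret block_jacobi T f \<omega> N by unfold_locales (use fdim fsa assms(1) in auto)
  have "(\<lambda>j. AE_entry f x ((T ^^ Suc j) \<omega>)) = (\<lambda>j. AE_entry f x ((T ^^ j) (T \<omega>)))"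
    by (simp add: funpow_swap1)
  then show "poly (char_poly H) (of_real x) = 0 \<longleftrightarrow> cos (2*pi*\<theta> N \<omega> x) = 0"
    unfolding root_iff_continuant[OF assms(2)] \<theta>_def by (simp only: continuant_eq_0_iff)
  show "poly (char_poly H) (of_real x) = 0 \<Longrightarrow> Polynomial.order (of_real x) (char_poly H) = 1"
    by (rule root_simple[OF assms(2)])
qed

lemma char_poly_root_real:
  assumes "0 < N" "poly (char_poly (trunc_op T f \<omega> N)) z = 0"
  shows "Im z = 0"
proof -
  interpret block_jacobi T f \<omega> N by unfold_locales (use fdim fsa assms(1) in auto)
  show ?thesis using hermitian_char_poly_root_real[OF H_carrier H_hermitian assms(2)] .
qed

lemma sum_order_real_roots:
  assumes N: "0 < N" and off: "\<And>x \<xi>. x \<in> S \<Longrightarrow> x \<noteq> f22 \<xi>"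
    and Z: "\<And>x. x \<in> S \<Longrightarrow> cos (2*pi*\<theta> N \<omega> x) = 0 \<longleftrightarrow> x \<in> Z" and "Z \<subseteq> S"
  shows "(\<Sum>z | poly (char_poly (trunc_op T f \<omega> N)) z = 0 \<and> Re z \<in> S.
      Polynomial.order z (char_poly (trunc_op T f \<omega> N))) = card Z"
proof -
  let ?P = "char_poly (trunc_op T f \<omega> N)"
  have set: "{z. poly ?P z = 0 \<and> Re z \<in> S} = complex_of_real ` Z"
  proof (intro Set.set_eqI iffI)
    fix z assume z: "z \<in> {z. poly ?P z = 0 \<and> Re z \<in> S}"
    then have zr: "z = of_real (Re z)" using char_poly_root_real[OF N, of \<omega> z] by (simp add: complex_eq_iff)
    then have "poly ?P (of_real (Re z)) = 0" using z by simp
    then have "Re z \<in> Z" using z char_poly_real_root(1)[OF N off, of "Re z"] Z[of "Re z"] by auto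
    then show "z \<in> complex_of_real ` Z" using zr by blast
  next
    fix z assume "z \<in> complex_of_real ` Z"
    then obtain x where x: "z = of_real x" "x \<in> Z" by blast
    then have "x \<in> S" using \<open>Z \<subseteq> S\<close> by blast
    then show "z \<in> {z. poly ?P z = 0 \<and> Re z \<in> S}"
      using x char_poly_real_root(1)[OF N off, of x] Z[of x] by auto
  qed
  have "Polynomial.order z ?P = 1" if "z \<in> complex_of_real ` Z" for z
  proof -
    have "poly ?P z = 0" "Re z \<in> S" "z = of_real (Re z)" using that set by auto
    then show ?thesis using char_poly_real_root(2)[OF N off, of "Re z"] by simp
  qed
  then have "(\<Sum>z\<in>complex_of_real ` Z. Polynomial.order z ?P) = card (complex_of_real ` Z)" by simp
  also have "\<dots> = card Z" by (rule card_image) (simp add: inj_on_def)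
  finally show ?thesis unfolding set .
qed

text \<open>The angle sees only eigenvalues off the range of \<open>f22\<close>, here those above
  \<open>E\<close>; their number is subtracted from the total \<open>2 * N\<close>.\<close>

lemma eig_count_above:
  assumes N: "0 < N" and E: "\<And>\<xi>. f22 \<xi> \<le> s" "s < E"
  shows "\<bar>real (eig_count (trunc_op T f \<omega> N) E) - (2 * real N - 2 * \<theta> N \<omega> E)\<bar> \<le> 3"
proof -
  let ?P = "char_poly (trunc_op T f \<omega> N)"
  have lt: "f22 \<xi> < x" if "E \<le> x" for x \<xi> using E(1)[of \<xi>] E(2) that by simp
  obtain X0 where X0: "\<And>x \<xi>. X0 \<le> x \<Longrightarrow> 2 \<le> AE_entry f x \<xi>" using AE_entry_large[OF E(1)] by metis
  define X where "X = max E X0"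
  have cone: "0 \<le> \<theta> N \<omega> x \<and> \<theta> N \<omega> x \<le> 1/8" if "X \<le> x" for x
    unfolding \<theta>_def using that X0 by (intro lift_iter_cone_pos) (simp add: X_def)
  \<comment> \<open>Beyond \<open>X\<close> the angle stays in the cone, so restricting the count to
    \<open>[E, X]\<close> misses no eigenvalue.\<close>
  have nz: "cos (2*pi*\<theta> N \<omega> x) \<noteq> 0" if "X \<le> x" for x
  proof -
    have "2*pi*\<theta> N \<omega> x \<le> 2*pi*(1/8)" "0 \<le> 2*pi*\<theta> N \<omega> x"
      using cone[OF that] by (auto intro!: mult_left_mono)
    then show ?thesis using cos_gt_zero_pi[of "2*pi*\<theta> N \<omega> x"] pi_gt_zero by simp
  qed
  define Z where "Z = {x\<in>{E..X}. cos (2*pi*\<theta> N \<omega> x) = 0}"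
  have "continuous_on {E..X} (\<theta> N \<omega>)" by (rule continuous_on_\<theta>) (use lt in force)
  moreover have "\<theta> N \<omega> y < \<theta> N \<omega> x" if "E \<le> x" "x < y" for x y
    using that lt N by (intro \<theta>_strict_antimono mult_pos_pos) auto
  ultimately have Z: "finite Z" "\<bar>real (card Z) - 2 * (\<theta> N \<omega> E - \<theta> N \<omega> X)\<bar> \<le> 1"
    unfolding Z_def by (intro card_cos_zeros; auto simp: X_def)+
  have above: "(\<Sum>z | poly ?P z = 0 \<and> Re z \<in> {E<..}. Polynomial.order z ?P) = card (Z - {E})"
  proof (rule sum_order_real_roots[OF N])
    show "x \<noteq> f22 \<xi>" if "x \<in> {E<..}" for x \<xi> using lt[of x \<xi>] that by simp
    show "cos (2*pi*\<theta> N \<omega> x) = 0 \<longleftrightarrow> x \<in> Z - {E}" if "x \<in> {E<..}" for x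
      using nz[of x] that by (cases "X \<le> x") (auto simp: Z_def)
  qed (auto simp: Z_def)
  have car: "trunc_op T f \<omega> N \<in> carrier_mat (2*N) (2*N)" by (simp add: trunc_op_def)
  note roots = sum_order_char_poly[OF car]
  have "{z. poly ?P z = 0} = {z. poly ?P z = 0 \<and> Im z = 0 \<and> Re z \<le> E} \<union> {z. poly ?P z = 0 \<and> Re z \<in> {E<..}}"
    using char_poly_root_real[OF N] by auto
  then have "(\<Sum>z | poly ?P z = 0. Polynomial.order z ?P) =
      (\<Sum>z\<in>{z. poly ?P z = 0 \<and> Im z = 0 \<and> Re z \<le> E} \<union> {z. poly ?P z = 0 \<and> Re z \<in> {E<..}}.
        Polynomial.order z ?P)" by (rule arg_cong)
  also have "\<dots> = eig_count (trunc_op T f \<omega> N) E + card (Z - {E})"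
    unfolding eig_count_def above[symmetric]
    by (rule sum.union_disjoint) (auto intro: finite_subset[OF _ roots(1)])
  finally have "2 * N = eig_count (trunc_op T f \<omega> N) E + card (Z - {E})" unfolding roots(2) .
  then have "2 * real N = real (eig_count (trunc_op T f \<omega> N) E) + real (card (Z - {E}))" by linarith
  \<comment> \<open>The error is at most 1 from counting crossings, 1 from an eigenvalue at
    \<open>E\<close> itself, which belongs to the lower count, and \<open>2 * 1/8\<close> from the
    angle at \<open>X\<close>.\<close>
  moreover have "real (card Z) \<le> real (card (Z - {E})) + 1" "real (card (Z - {E})) \<le> real (card Z)"
    using Z(1) by (auto simp: card_Diff_singleton_if)
  moreover have "0 \<le> \<theta> N \<omega> X" "\<theta> N \<omega> X \<le> 1/8" using cone[OF order_refl] by auto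
  ultimately show ?thesis using Z(2) unfolding right_diff_distrib by linarith
qed

text \<open>Here the eigenvalues up to \<open>E\<close> are counted directly, while the angle falls
  from about \<open>N/2\<close> at very negative energies; twice that value is the \<open>N\<close>
  in the formula.\<close>

lemma eig_count_below:
  assumes N: "0 < N" and E: "\<And>\<xi>. s \<le> f22 \<xi>" "E < s"
  shows "\<bar>real (eig_count (trunc_op T f \<omega> N) E) - (real N - 2 * \<theta> N \<omega> E)\<bar> \<le> 3"
proof -
  let ?P = "char_poly (trunc_op T f \<omega> N)"
  have lt: "x < f22 \<xi>" if "x \<le> E" for x \<xi> using E(1)[of \<xi>] E(2) that by simp
  obtain X0 where X0: "\<And>x \<xi>. x \<le> X0 \<Longrightarrow> AE_entry f x \<xi> \<le> -2" using AE_entry_small[OF E(1)] by metis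
  define X where "X = min E X0"
  have cone: "real N / 2 - 1/8 \<le> \<theta> N \<omega> x \<and> \<theta> N \<omega> x \<le> real N / 2" if "x \<le> X" for x
    unfolding \<theta>_def using that X0 by (intro lift_iter_cone_neg) (simp add: X_def)
  have nz: "cos (2*pi*\<theta> N \<omega> x) \<noteq> 0" if "x \<le> X" for x
  proof -
    \<comment> \<open>The deficit from \<open>N/2\<close> lies in \<open>[0, 1/8]\<close>, and the
      subtraction from a multiple of pi changes the cosine at most by a sign.\<close>
    define d where "d = real N / 2 - \<theta> N \<omega> x"
    have "2*pi*d \<le> 2*pi*(1/8)" "0 \<le> 2*pi*d"
      using cone[OF that] by (auto simp: d_def intro!: mult_left_mono)
    then have "cos (2*pi*d) \<noteq> 0" using cos_gt_zero_pi[of "2*pi*d"] pi_gt_zero by simp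
    moreover have "2*pi*\<theta> N \<omega> x = real N * pi - 2*pi*d" by (simp add: d_def algebra_simps)
    ultimately show ?thesis by (simp add: cos_diff)
  qed
  define Z where "Z = {x\<in>{X..E}. cos (2*pi*\<theta> N \<omega> x) = 0}"
  have "continuous_on {X..E} (\<theta> N \<omega>)" by (rule continuous_on_\<theta>) (use lt in force)
  moreover have "\<theta> N \<omega> y < \<theta> N \<omega> x" if "x < y" "y \<le> E" for x y
    using that lt N by (intro \<theta>_strict_antimono mult_neg_neg) auto
  ultimately have Z: "\<bar>real (card Z) - 2 * (\<theta> N \<omega> X - \<theta> N \<omega> E)\<bar> \<le> 1"
    unfolding Z_def by (intro card_cos_zeros; auto simp: X_def)
  have below: "(\<Sum>z | poly ?P z = 0 \<and> Re z \<in> {..E}. Polynomial.order z ?P) = card Z"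
  proof (rule sum_order_real_roots[OF N])
    show "x \<noteq> f22 \<xi>" if "x \<in> {..E}" for x \<xi> using lt[of x \<xi>] that by simp
    show "cos (2*pi*\<theta> N \<omega> x) = 0 \<longleftrightarrow> x \<in> Z" if "x \<in> {..E}" for x
      using nz[of x] that by (cases "x \<le> X") (auto simp: Z_def)
  qed (auto simp: Z_def)
  have "{z. poly ?P z = 0 \<and> Im z = 0 \<and> Re z \<le> E} = {z. poly ?P z = 0 \<and> Re z \<in> {..E}}"
    using char_poly_root_real[OF N] by auto
  then have "real (eig_count (trunc_op T f \<omega> N) E) = real (card Z)"
    unfolding eig_count_def below[symmetric] by simp
  moreover have "real N / 2 - 1/8 \<le> \<theta> N \<omega> X" "\<theta> N \<omega> X \<le> real N / 2"
    using cone[OF order_refl] by auto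
  ultimately show ?thesis using Z unfolding right_diff_distrib by linarith
qed

text \<open>The constant \<open>c\<close> is 1 above and 1/2 below the range of \<open>f22\<close>;
  a bounded counting error disappears on division by \<open>2 * N\<close>.\<close>

lemma ids_seq_limit:
  assumes rot: "\<And>\<omega> t. (\<lambda>n. (lift_iter T (AE_entry f E) n \<omega> t - t) / real n) \<longlonglongrightarrow> \<rho>"
    and count: "\<And>N. 0 < N \<Longrightarrow>
      \<bar>real (eig_count (trunc_op T f \<omega> N) E) - (2 * c * real N - 2 * \<theta> N \<omega> E)\<bar> \<le> 3"
  shows "ids_seq T f E \<omega> \<longlonglongrightarrow> c - \<rho>"
proof -
  have "(\<lambda>N. ids_seq T f E \<omega> N - (c - \<theta> N \<omega> E / real N)) \<longlonglongrightarrow> 0"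
  proof (rule Lim_null_comparison)
    show "eventually (\<lambda>N. norm (ids_seq T f E \<omega> N - (c - \<theta> N \<omega> E / real N)) \<le> (3/2) / real N) sequentially"
      using eventually_gt_at_top[of 0]
    proof eventually_elim
      case (elim N)
      have "ids_seq T f E \<omega> N - (c - \<theta> N \<omega> E / real N)
        = (real (eig_count (trunc_op T f \<omega> N) E) - (2 * c * real N - 2 * \<theta> N \<omega> E)) / (2 * real N)"
        using elim by (simp add: ids_seq_def field_simps)
      also have "norm \<dots> \<le> 3 / (2 * real N)"
        using count[OF elim] by (simp add: abs_divide divide_right_mono)
      finally show ?case by simp
    qed
    show "(\<lambda>N. (3/2) / real N) \<longlonglongrightarrow> 0" by (rule lim_const_over_n)
  qed
  moreover have "(\<lambda>N. c - \<theta> N \<omega> E / real N) \<longlonglongrightarrow> c - \<rho>"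
    unfolding \<theta>_def using rot[of "T \<omega>" 0] by (intro tendsto_intros) simp
  ultimately show ?thesis using tendsto_add by fastforce
qed

end

theorem theorem5p10:
  fixes T :: "'a::metric_space \<Rightarrow> 'a" and \<nu> :: "'a measure"
    and f :: "'a \<Rightarrow> complex mat"
  assumes cpt: "compact (UNIV :: 'a set)"
    and homeo: "bij T" "continuous_on UNIV T" "continuous_on UNIV (inv_into UNIV T)"
    and ue: "uniquely_ergodic T \<nu>"
    and fdim: "\<And>\<omega>. f \<omega> \<in> carrier_mat 2 2"
    and fcont: "\<And>i j. i < 2 \<Longrightarrow> j < 2 \<Longrightarrow> continuous_on UNIV (\<lambda>\<omega>. f \<omega> $$ (i,j))"
    and fsa: "\<And>\<omega>. mat_adjoint (f \<omega>) = f \<omega>"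
    and generic: "AE \<omega> in \<nu>. (\<forall>i::int. f (tpow T i \<omega>) $$ (0,1) \<noteq> 0) \<and>
        (\<forall>i j::int. i \<noteq> j \<longrightarrow> f (tpow T i \<omega>) $$ (1,1) \<noteq> f (tpow T j \<omega>) $$ (1,1))"
  shows "(\<forall>E. E > (SUP \<omega>. Re (f \<omega> $$ (1,1))) \<longrightarrow>
            (AE \<omega> in \<nu>. ids_seq T f E \<omega> \<longlonglongrightarrow> 1 - rot_num T (AE_entry f E)))
       \<and> (\<forall>E. E < (INF \<omega>. Re (f \<omega> $$ (1,1))) \<longrightarrow>
            (AE \<omega> in \<nu>. ids_seq T f E \<omega> \<longlonglongrightarrow> 1/2 - rot_num T (AE_entry f E)))"
proof -
  interpret block_jacobi_family T f by unfold_locales (use cpt fdim fcont fsa in auto)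
  have sup: "f22 \<xi> \<le> (SUP \<omega>. f22 \<omega>)" and inf: "(INF \<omega>. f22 \<omega>) \<le> f22 \<xi>" for \<xi>
    using bdd_f22 by (auto intro: cSUP_upper cINF_lower)
  show ?thesis
  proof (intro conjI allI impI)
    fix E assume E: "E > (SUP \<omega>. f22 \<omega>)"
    then have "E \<noteq> f22 \<xi>" for \<xi> using sup[of \<xi>] by simp
    then have rot: "(\<lambda>n. (lift_iter T (AE_entry f E) n \<omega> t - t) / real n) \<longlonglongrightarrow> rot_num T (AE_entry f E)"
      for \<omega> t by (intro rot_num_limit[OF cpt homeo ue] continuous_on_AE_entry)
    \<comment> \<open>Convergence holds at every \<open>\<omega>\<close>, because the Birkhoff
      averages behind the rotation number converge everywhere.\<close>
    have "ids_seq T f E \<omega> \<longlonglongrightarrow> 1 - rot_num T (AE_entry f E)" for \<omega>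
      using eig_count_above[OF _ sup E] by (intro ids_seq_limit rot) simp
    then show "AE \<omega> in \<nu>. ids_seq T f E \<omega> \<longlonglongrightarrow> 1 - rot_num T (AE_entry f E)" by simp
  next
    fix E assume E: "E < (INF \<omega>. f22 \<omega>)"
    then have "E \<noteq> f22 \<xi>" for \<xi> using inf[of \<xi>] by simp
    then have rot: "(\<lambda>n. (lift_iter T (AE_entry f E) n \<omega> t - t) / real n) \<longlonglongrightarrow> rot_num T (AE_entry f E)"
      for \<omega> t by (intro rot_num_limit[OF cpt homeo ue] continuous_on_AE_entry)
    have "ids_seq T f E \<omega> \<longlonglongrightarrow> 1/2 - rot_num T (AE_entry f E)" for \<omega>
      using eig_count_below[OF _ inf E] by (intro ids_seq_limit rot) simp
    then show "AE \<omega> in \<nu>. ids_seq T f E \<omega> \<longlonglongrightarrow> 1/2 - rot_num T (AE_entry f E)" by simp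
  qed
qed

end
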